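(* Let $\alpha>0$ be a real number. For any $\epsilon>0$ there exists a non-decreasing sequence $\{\varphi(n)\}_{n=1}^\infty$ of positive real numbers with $$\liminf_{n\to\infty}\frac{\varphi(n)}{n}<\infty\quad\text{and}\quad \limsup_{n\to\infty}\frac{\varphi(n)}{n}=\infty$$ such that $1-\dim_H E_{\varphi(n),\alpha}<\epsilon$.
   Context: Every irrational $x\in(0,1)$ has a continued fraction expansion $x=[a_1(x),a_2(x),\dots]$ with positive integer partial quotients $a_j(x)$. Let $s_n(x)=\sum_{j=1}^n a_j(x)$. For a sequence $\{\varphi(n)\}$ of positive reals and $\alpha\ge 0$, $E_{\varphi(n),\alpha}:=\{x\in(0,1)\setminus\mathbb{Q}: \lim_{n\to\infty} s_n(x)/\varphi(n)=\alpha\}$. $\dim_H$ denotes Hausdorff dimension. *)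

theory Defs
  imports "HOL-Analysis.Analysis"
begin

subsection \<open>Continued fractions\<close>

definition gauss_map :: "real \<Rightarrow> real" where
  "gauss_map x = frac (1 / x)"

text \<open>Partial quotients are indexed from 1; the value at index 0 is irrelevant.\<close>

definition partial_quotient :: "real \<Rightarrow> nat \<Rightarrow> nat" where
  "partial_quotient x j = nat \<lfloor>1 / (gauss_map ^^ (j - 1)) x\<rfloor>"

definition quotient_sum :: "nat \<Rightarrow> real \<Rightarrow> nat" where
  "quotient_sum n x = (\<Sum>j=1..n. partial_quotient x j)"

text \<open>
  The value of the finite continued fraction \<open>[a\<^sub>1, \<dots>, a\<^sub>n] = 1 / (a\<^sub>1 + 1 / (a\<^sub>2 + \<dots>))\<close>.
  It is used only to confirm that \<^const>\<open>partial_quotient\<close> yields the continued fraction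
  expansion: by \<open>is_cfrac_expansion_partial_quotient\<close> and \<open>is_cfrac_expansion_unique\<close>, the
  partial quotients of an irrational \<open>x \<in> (0,1)\<close> are the unique sequence of positive integers
  whose continued fraction converges to \<open>x\<close>.
\<close>

primrec cfrac_value :: "nat list \<Rightarrow> real" where
  "cfrac_value [] = 0"
| "cfrac_value (a # as) = 1 / (real a + cfrac_value as)"

definition is_cfrac_expansion :: "(nat \<Rightarrow> nat) \<Rightarrow> real \<Rightarrow> bool" where
  "is_cfrac_expansion a x \<longleftrightarrow>
     (\<forall>j\<ge>1. a j > 0) \<and> (\<lambda>n. cfrac_value (map a [1..<Suc n])) \<longlonglongrightarrow> x"

lemma gauss_map_irrational:
  assumes "x \<in> {0<..<1} - \<rat>"
  shows "gauss_map x \<in> {0<..<1} - \<rat>"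
proof -
  have "1 / x \<notin> \<rat>"
  proof
    assume "1 / x \<in> \<rat>"
    then show False using Rats_divide[of 1 "1 / x"] assms by simp
  qed
  then have "1 / x \<notin> \<int>" "frac (1 / x) \<notin> \<rat>"
    using Ints_subset_Rats Rats_add[of "frac (1 / x)" "of_int \<lfloor>1 / x\<rfloor>"]
    by (auto simp: frac_def)
  then show ?thesis
    by (simp add: gauss_map_def frac_lt_1)
qed

lemma gauss_map_funpow_irrational:
  "x \<in> {0<..<1} - \<rat> \<Longrightarrow> (gauss_map ^^ n) x \<in> {0<..<1} - \<rat>"
  by (induction n) (use gauss_map_irrational in auto)

lemma partial_quotient_pos:
  assumes "x \<in> {0<..<1} - \<rat>"
  shows "partial_quotient x j > 0"
proof -
  have "1 / (gauss_map ^^ (j - 1)) x > 1"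
    using gauss_map_funpow_irrational[OF assms, of "j - 1"] by simp
  then show ?thesis unfolding partial_quotient_def by linarith
qed

lemma partial_quotient_Suc:
  "j \<ge> 1 \<Longrightarrow> partial_quotient x (Suc j) = partial_quotient (gauss_map x) j"
  by (cases j) (simp_all add: partial_quotient_def funpow_swap1)

lemma eq_partial_quotient_gauss_map:
  assumes "x \<in> {0<..<1} - \<rat>"
  shows "x = 1 / (real (partial_quotient x 1) + gauss_map x)"
proof -
  have "\<lfloor>1 / x\<rfloor> \<ge> 0" using assms by simp
  then have "real (partial_quotient x 1) = of_int \<lfloor>1 / x\<rfloor>"
    by (simp add: partial_quotient_def)
  then have "real (partial_quotient x 1) + gauss_map x = 1 / x"
    by (simp add: gauss_map_def frac_def)
  then show ?thesis by simp
qed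

lemma cfrac_value_shift:
  "cfrac_value (map a [1..<Suc (Suc n)]) =
     1 / (real (a 1) + cfrac_value (map (\<lambda>j. a (Suc j)) [1..<Suc n]))"
proof -
  have "[1..<Suc (Suc n)] = 1 # map Suc [1..<Suc n]"
    by (simp add: map_Suc_upt upt_conv_Cons del: upt_Suc)
  then show ?thesis by (simp add: comp_def del: upt_Suc)
qed

lemma cfrac_value_bounds:
  assumes "\<forall>a\<in>set as. a > 0"
  shows "0 \<le> cfrac_value as \<and> cfrac_value as \<le> 1"
  using assms by (induction as) (auto simp: divide_simps)

lemma inverse_diff_bound:
  fixes a y z :: real
  assumes "a \<ge> 1" "y \<ge> 0" "z \<ge> 0"
  shows "\<bar>1 / (a + y) - 1 / (a + z)\<bar> \<le> \<bar>y - z\<bar> * (1 / (a + y))"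
proof -
  have pos: "a + y > 0" "a + z \<ge> 1" using assms by auto
  have "1 / (a + y) - 1 / (a + z) = (z - y) * (1 / (a + y)) * (1 / (a + z))"
    using pos by (simp add: field_simps)
  then have "\<bar>1 / (a + y) - 1 / (a + z)\<bar> = \<bar>y - z\<bar> * (1 / (a + y)) * (1 / (a + z))"
    using pos by (simp add: abs_mult abs_minus_commute)
  also have "\<dots> \<le> \<bar>y - z\<bar> * (1 / (a + y)) * 1"
    using pos by (intro mult_left_mono) (auto simp: divide_simps)
  finally show ?thesis by simp
qed

lemma cfrac_value_partial_quotients_error:
  assumes "x \<in> {0<..<1} - \<rat>"
  shows "\<bar>x - cfrac_value (map (partial_quotient x) [1..<Suc n])\<bar> \<le> (1 / 2) ^ (n div 2)"
  using assms
proof (induction n arbitrary: x rule: induct_nat_012)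
  case 0
  then show ?case by auto
next
  case 1
  let ?c = "cfrac_value (map (partial_quotient x) [1..<Suc 1])"
  have "0 \<le> ?c \<and> ?c \<le> 1"
    by (rule cfrac_value_bounds) (simp add: partial_quotient_pos[OF 1])
  moreover have "0 < x" "x < 1" using 1 by simp_all
  ultimately have "\<bar>x - ?c\<bar> \<le> 1" by linarith
  then show ?case by simp
next
  case (ge2 n x)
  define c where "c = (\<lambda>y n. cfrac_value (map (partial_quotient y) [1..<Suc n]))"
  have c_Suc: "c y (Suc m) = 1 / (real (partial_quotient y 1) + c (gauss_map y) m)" for y m
    unfolding c_def cfrac_value_shift
    by (intro arg_cong[where f = "\<lambda>as. 1 / (real (partial_quotient y 1) + cfrac_value as)"])
       (auto simp: partial_quotient_Suc simp del: upt_Suc)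
  have c_nonneg: "c y m \<ge> 0" if "y \<in> {0<..<1} - \<rat>" for y m
    unfolding c_def using partial_quotient_pos[OF that] by (intro conjunct1[OF cfrac_value_bounds]) auto
  have step: "\<bar>y - c y (Suc m)\<bar> \<le> \<bar>gauss_map y - c (gauss_map y) m\<bar> * y"
    if y: "y \<in> {0<..<1} - \<rat>" for y m
  proof -
    have 1: "real (partial_quotient y 1) \<ge> 1" using partial_quotient_pos[OF y, of 1] by simp
    have 2: "gauss_map y \<ge> 0" using gauss_map_irrational[OF y] by simp
    have 3: "1 / (real (partial_quotient y 1) + gauss_map y) = y"
      using eq_partial_quotient_gauss_map[OF y] by simp
    show ?thesis
      using inverse_diff_bound[OF 1 2 c_nonneg[OF gauss_map_irrational[OF y], of m]]
      unfolding c_Suc 3 .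
  qed
  let ?y = "gauss_map x" and ?z = "gauss_map (gauss_map x)"
  have y: "?y \<in> {0<..<1} - \<rat>" using gauss_map_irrational[OF ge2.prems] .
  have z: "?z \<in> {0<..<1} - \<rat>" using gauss_map_irrational[OF y] .
  have half: "?y * x \<le> 1 / 2"
  proof -
    have "real (partial_quotient x 1) \<ge> 1"
      using partial_quotient_pos[OF ge2.prems, of 1] by simp
    then have "?y * (1 / (real (partial_quotient x 1) + ?y)) \<le> 1 / 2"
      using y by (auto simp: divide_simps)
    then show ?thesis unfolding eq_partial_quotient_gauss_map[OF ge2.prems, symmetric] .
  qed
  have "\<bar>x - c x (Suc (Suc n))\<bar> \<le> \<bar>?y - c ?y (Suc n)\<bar> * x"
    by (rule step[OF ge2.prems])
  also have "\<dots> \<le> (\<bar>?z - c ?z n\<bar> * ?y) * x"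
    using ge2.prems by (intro mult_right_mono step[OF y]) auto
  also have "\<dots> = \<bar>?z - c ?z n\<bar> * (?y * x)" by (simp add: mult.assoc)
  also have "\<dots> \<le> (1 / 2) ^ (n div 2) * (1 / 2)"
    using ge2.IH(1)[OF z] half y ge2.prems unfolding c_def
    by (intro mult_mono) auto
  finally show ?case by (simp add: c_def del: upt_Suc)
qed

lemma is_cfrac_expansion_partial_quotient:
  assumes "x \<in> {0<..<1} - \<rat>"
  shows "is_cfrac_expansion (partial_quotient x) x"
proof -
  let ?c = "\<lambda>n. cfrac_value (map (partial_quotient x) [1..<Suc n])"
  have div2: "filterlim (\<lambda>n::nat. n div 2) at_top sequentially"
    unfolding filterlim_at_top eventually_sequentially
  proof
    fix Z :: nat
    have "\<forall>n\<ge>2 * Z. Z \<le> n div 2" by presburger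
    then show "\<exists>N. \<forall>n\<ge>N. Z \<le> n div 2" ..
  qed
  have pow: "(\<lambda>n. (1 / 2 :: real) ^ n) \<longlonglongrightarrow> 0"
    by (rule LIMSEQ_realpow_zero) simp_all
  have "(\<lambda>n. ?c n - x) \<longlonglongrightarrow> 0"
  proof (rule Lim_null_comparison[OF always_eventually filterlim_compose[OF pow div2]], rule allI)
    fix n
    show "norm (?c n - x) \<le> (1 / 2) ^ (n div 2)"
      unfolding real_norm_def abs_minus_commute[of "?c n" x]
      by (rule cfrac_value_partial_quotients_error[OF assms])
  qed
  then have "?c \<longlonglongrightarrow> x" by (rule LIM_zero_cancel)
  then show ?thesis
    using partial_quotient_pos[OF assms] unfolding is_cfrac_expansion_def by blast
qed

lemma is_cfrac_expansion_unique:
  assumes "x \<in> {0<..<1} - \<rat>" "is_cfrac_expansion a x" "j \<ge> 1"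
  shows "a j = partial_quotient x j"
  using assms(3,1,2)
proof (induction j arbitrary: x a rule: dec_induct)
  fix x a
  assume x: "x \<in> {0<..<1} - \<rat>" and a: "is_cfrac_expansion a x"
  define b where "b = (\<lambda>j. a (Suc j))"
  define t where "t = (\<lambda>n. cfrac_value (map b [1..<Suc n]))"
  have "(\<lambda>n. cfrac_value (map a [1..<Suc n])) \<longlonglongrightarrow> x"
    using a unfolding is_cfrac_expansion_def by (rule conjunct2)
  then have "(\<lambda>n. cfrac_value (map a [1..<Suc (Suc n)])) \<longlonglongrightarrow> x"
    by (rule LIMSEQ_Suc)
  then have lim: "(\<lambda>n. 1 / (real (a 1) + t n)) \<longlonglongrightarrow> x"
    unfolding cfrac_value_shift t_def b_def .
  have "(\<lambda>n. 1 / (1 / (real (a 1) + t n)) - real (a 1)) \<longlonglongrightarrow> 1 / x - real (a 1)"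
    using x by (intro tendsto_intros lim) auto
  then have t: "t \<longlonglongrightarrow> 1 / x - real (a 1)" by simp
  have bpos: "\<forall>j\<ge>1. b j > 0" using a by (auto simp: b_def is_cfrac_expansion_def)
  then have "0 \<le> t n \<and> t n \<le> 1" for n
    unfolding t_def by (intro cfrac_value_bounds) auto
  then have "0 \<le> 1 / x - real (a 1)" "1 / x - real (a 1) \<le> 1"
    using LIMSEQ_le_const[OF t, of 0] LIMSEQ_le_const2[OF t, of 1] by auto
  moreover have "1 / x - real (a 1) \<noteq> 1"
  proof
    assume "1 / x - real (a 1) = 1"
    then have "x = 1 / (real (a 1) + 1)" using x by (simp add: field_simps)
    also have "\<dots> \<in> \<rat>" by (intro Rats_divide Rats_add) auto
    finally show False using x by simp
  qed
  ultimately have fl: "\<lfloor>1 / x\<rfloor> = int (a 1)" by linarith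
  then show "a 1 = partial_quotient x 1" by (simp add: partial_quotient_def)
  have "1 / x - real (a 1) = gauss_map x" by (simp add: gauss_map_def frac_def fl)
  then have ex: "is_cfrac_expansion b (gauss_map x)"
    using t bpos unfolding is_cfrac_expansion_def t_def by simp
  fix n :: nat
  assume "1 \<le> n" and IH: "\<And>x a. x \<in> {0<..<1} - \<rat> \<Longrightarrow> is_cfrac_expansion a x \<Longrightarrow>
    a n = partial_quotient x n"
  then show "a (Suc n) = partial_quotient x (Suc n)"
    using IH[OF gauss_map_irrational[OF x] ex] by (simp add: b_def partial_quotient_Suc)
qed

definition quotient_sum_limit_set :: "(nat \<Rightarrow> real) \<Rightarrow> real \<Rightarrow> real set" where
  "quotient_sum_limit_set \<phi> \<alpha> =
     {x \<in> {0<..<1} - \<rat>. (\<lambda>n. real (quotient_sum n x) / \<phi> n) \<longlonglongrightarrow> \<alpha>}"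

subsection \<open>Hausdorff measure and dimension\<close>

text \<open>
  The weight \<open>diam(U)\<^sup>s\<close>, with the usual conventions \<open>diam(\<emptyset>)\<^sup>s = 0\<close> for all \<open>s\<close> and
  \<open>diam(U)\<^sup>0 = 1\<close> for \<open>U \<noteq> \<emptyset>\<close>, whereas \<open>0 powr 0 = 0\<close> in the library.
\<close>

definition diameter_weight :: "real \<Rightarrow> 'a::metric_space set \<Rightarrow> ennreal" where
  "diameter_weight s U =
     (if U = {} then 0 else if s = 0 then 1 else ennreal (diameter U powr s))"

text \<open>
  Covers are restricted to bounded sets because \<^const>\<open>diameter\<close> is unspecified on unbounded ones.
\<close>

definition hausdorff_premeasure :: "real \<Rightarrow> real \<Rightarrow> 'a::metric_space set \<Rightarrow> ennreal" where
  "hausdorff_premeasure s \<delta> X =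
     (INF U \<in> {U :: nat \<Rightarrow> 'a set.
        X \<subseteq> (\<Union>i. U i) \<and> (\<forall>i. bounded (U i) \<and> diameter (U i) \<le> \<delta>)}.
        (\<Sum>i. diameter_weight s (U i)))"

definition hausdorff_measure :: "real \<Rightarrow> 'a::metric_space set \<Rightarrow> ennreal" where
  "hausdorff_measure s X = (SUP \<delta>\<in>{0<..}. hausdorff_premeasure s \<delta> X)"

definition hausdorff_dim :: "'a::metric_space set \<Rightarrow> ereal" where
  "hausdorff_dim X = (INF s \<in> {s. 0 \<le> s \<and> hausdorff_measure s X = 0}. ereal s)"

end

theory Submission
  imports Defs "HOL-Probability.Probability" "HOL-Real_Asymp.Real_Asymp"
begin

text \<open>
  Build digit sequences from blocks: a large \<open>M\<close> and a long block length \<open>L\<close> are fixed, and the words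
  in \<open>{1..M}\<^sup>L\<close> are restricted to a set \<open>W\<close> with one common digit sum. By pigeonhole this is
  cheap, and \<open>\<Sum>w\<in>W. |I(w)|\<^sup>s\<close> can still be made as large as desired for any given \<open>s < 1\<close>, where
  \<open>I(w)\<close> is the fundamental interval of \<open>w\<close>. Each block from \<open>W\<close> is preceded by one prescribed digit
  \<open>b\<^sub>i\<close>, which is \<open>1\<close> except at very sparse places, where it is \<open>i\<^sup>2\<close>. The sums \<open>s\<^sub>n\<close> of any two
  such sequences differ by a bounded amount, so \<open>\<phi>(n) = s\<^sub>n(x\<^sub>0) / \<alpha>\<close> works for all of them; the
  sparse digits make \<open>\<phi>(n) / n\<close> unbounded and yet bounded along a subsequence. Choosing the blocks
  independently with probability proportional to \<open>|I(w)|\<^sup>s\<close> gives a measure to which the mass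
  distribution principle applies with exponent \<open>s\<close>: the losses caused by the prescribed digits are at
  most exponential in the number of blocks and are absorbed by the large constant.
\<close>

subsection \<open>Fundamental intervals\<close>

text \<open>The inverse branch of the iterated Gauss map that belongs to a word. The argument
  \<open>z\<close> is the value of the tail not yet read, so for positive digits [0,1] is carried
  onto the closed fundamental interval.\<close>

primrec cf_map :: "nat list \<Rightarrow> real \<Rightarrow> real" where
  "cf_map [] z = z"
| "cf_map (a # w) z = 1 / (real a + cf_map w z)"

text \<open>
  In terms of the convergents' denominators \<open>q\<^sub>n\<close> of a word of length \<open>n\<close>, \<open>cf_denom w z\<close> is
  \<open>q\<^sub>n + z q\<^sub>n\<^sub>-\<^sub>1\<close>, and \<open>cf_size w = q\<^sub>n (q\<^sub>n + q\<^sub>n\<^sub>-\<^sub>1)\<close> is the reciprocal length of the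
  fundamental interval of \<open>w\<close>.
\<close>

primrec cf_denom :: "nat list \<Rightarrow> real \<Rightarrow> real" where
  "cf_denom [] z = 1"
| "cf_denom (a # w) z = (real a + cf_map w z) * cf_denom w z"

definition cf_size :: "nat list \<Rightarrow> real" where
  "cf_size w = cf_denom w 0 * cf_denom w 1"

lemma cf_map_append: "cf_map (u @ v) z = cf_map u (cf_map v z)"
  by (induction u) auto

lemma cf_denom_append: "cf_denom (u @ v) z = cf_denom u (cf_map v z) * cf_denom v z"
  by (induction u) (auto simp: cf_map_append)

lemma cf_map_nonneg: "0 \<le> z \<Longrightarrow> 0 \<le> cf_map w z"
  by (induction w) auto

lemma cf_map_le_1:
  assumes "0 \<notin> set w" "0 \<le> z" "z \<le> 1"
  shows "cf_map w z \<le> 1"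
proof (cases w)
  case (Cons a v)
  then show ?thesis using assms cf_map_nonneg[of z v] by (auto simp: divide_simps)
qed (use assms in simp)

text \<open>Each step from z to 1 / (a + z) divides a distance by the product of the two
  denominators, and \<open>cf_denom\<close> collects these factors. The result is an exact identity
  that serves in place of derivative estimates.\<close>

lemma cf_map_diff:
  assumes "0 \<notin> set w" "0 \<le> z" "0 \<le> z'"
  shows "\<bar>cf_map w z - cf_map w z'\<bar> * (cf_denom w z * cf_denom w z') = \<bar>z - z'\<bar>"
  using assms(1)
proof (induction w)
  case (Cons a w)
  define x y where "x = cf_map w z" and "y = cf_map w z'"
  have "a > 0" using Cons.prems by auto
  then have pos: "real a + x > 0" "real a + y > 0"
    using cf_map_nonneg[OF assms(2), of w] cf_map_nonneg[OF assms(3), of w] by (auto simp: x_def y_def)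
  have "1 / (real a + x) - 1 / (real a + y) = (y - x) / ((real a + x) * (real a + y))"
    using pos by (simp add: field_simps)
  then have "\<bar>1 / (real a + x) - 1 / (real a + y)\<bar> * ((real a + x) * (real a + y)) = \<bar>x - y\<bar>"
    using pos by (simp add: abs_mult abs_minus_commute)
  moreover have "\<bar>x - y\<bar> * (cf_denom w z * cf_denom w z') = \<bar>z - z'\<bar>"
    using Cons by (simp add: x_def y_def)
  moreover have "d * ((u * e) * (v * f)) = (d * (u * v)) * (e * f)" for d e f u v :: real
    by (simp add: mult_ac)
  ultimately show ?case by (simp only: cf_map.simps cf_denom.simps x_def y_def)
qed simp

text \<open>The coefficients \<open>q\<close> and \<open>p\<close> are the denominators of the last
  two convergents. Induction from the right is their usual recurrence: appending \<open>a\<close>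
  turns (q, p) into (q a + p, q).\<close>

lemma cf_denom_affine:
  assumes "0 \<notin> set w"
  obtains p q where "0 \<le> p" "p \<le> q" "1 \<le> q" "\<And>z. 0 \<le> z \<Longrightarrow> cf_denom w z = q + p * z"
proof -
  have "\<exists>p q. 0 \<le> p \<and> p \<le> q \<and> 1 \<le> q \<and> (\<forall>z\<ge>0. cf_denom w z = q + p * z)"
    using assms
  proof (induction w rule: rev_induct)
    case Nil
    show ?case by (intro exI[of _ 0] exI[of _ 1]) auto
  next
    case (snoc a w)
    then obtain p q where pq: "0 \<le> p" "p \<le> q" "1 \<le> q" "\<forall>z\<ge>0. cf_denom w z = q + p * z"
      by auto
    have a: "real a \<ge> 1" using snoc.prems by (cases a) auto
    have "q * 1 \<le> q * real a" using a pq by (intro mult_left_mono) auto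
    then have "0 \<le> q" "q \<le> q * real a + p" "1 \<le> q * real a + p" using pq(1-3) by linarith+
    moreover have "(q + p * (1 / t)) * t = q * t + p" if "t > 0" for t
      using that by (simp add: distrib_right)
    then have "\<forall>z\<ge>0. cf_denom (w @ [a]) z = (q * real a + p) + q * z"
      using a pq(4) by (auto simp: cf_denom_append distrib_left[symmetric] add.assoc)
    ultimately show ?case by blast
  qed
  then show ?thesis using that by blast
qed

lemma cf_denom_bounds:
  assumes "0 \<notin> set w" "0 \<le> z" "z \<le> 1"
  shows "1 \<le> cf_denom w 0" "cf_denom w 0 \<le> cf_denom w z" "cf_denom w z \<le> 2 * cf_denom w 0"
proof -
  obtain p q where pq: "0 \<le> p" "p \<le> q" "1 \<le> q" "\<And>z. 0 \<le> z \<Longrightarrow> cf_denom w z = q + p * z"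
    using cf_denom_affine[OF assms(1)] by blast
  have "p * z \<le> p * 1" using assms pq by (intro mult_left_mono) auto
  then show "1 \<le> cf_denom w 0" "cf_denom w 0 \<le> cf_denom w z" "cf_denom w z \<le> 2 * cf_denom w 0"
    using pq assms by auto
qed

lemma cf_size_pos: "0 \<notin> set w \<Longrightarrow> 0 < cf_size w"
  using cf_denom_bounds[of w 1] by (auto simp: cf_size_def intro!: mult_pos_pos)

text \<open>Bounded distortion: as p \<le> q, the product lies between q q and (q + p) (q + p), and
  both are within a factor 2 of q (q + p).\<close>

lemma cf_denom_mult_le_size:
  assumes "0 \<notin> set w" "0 \<le> z" "z \<le> 1" "0 \<le> z'" "z' \<le> 1"
  shows "cf_denom w z * cf_denom w z' \<le> 2 * cf_size w" "cf_size w \<le> 2 * (cf_denom w z * cf_denom w z')"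
proof -
  obtain p q where pq: "0 \<le> p" "p \<le> q" "1 \<le> q" "\<And>z. 0 \<le> z \<Longrightarrow> cf_denom w z = q + p * z"
    using cf_denom_affine[OF assms(1)] by blast
  have le: "p * z \<le> p * 1" "p * z' \<le> p * 1" using assms pq by (intro mult_left_mono; auto)+
  have "(q + p * z) * (q + p * z') \<le> (q + p) * (2 * q)"
    using le pq assms by (intro mult_mono) auto
  then show "cf_denom w z * cf_denom w z' \<le> 2 * cf_size w"
    using pq assms by (simp add: cf_size_def algebra_simps)
  have "q * (q + p) \<le> q * (2 * q)" using pq by (intro mult_left_mono) auto
  moreover have "q * q \<le> (q + p * z) * (q + p * z')" using pq assms by (intro mult_mono) auto
  ultimately have "q * (q + p) \<le> 2 * ((q + p * z) * (q + p * z'))" by linarith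
  then show "cf_size w \<le> 2 * (cf_denom w z * cf_denom w z')"
    using pq assms by (simp add: cf_size_def)
qed

text \<open>The size of \<open>u @ v\<close> is the size of \<open>v\<close> times the denominators
  of \<open>u\<close> at the endpoints of the interval of \<open>v\<close>; distortion replaces
  these endpoints by 0 and 1 at the cost of a factor 2.\<close>

lemma cf_size_append_le:
  assumes "0 \<notin> set u" "0 \<notin> set v"
  shows "cf_size (u @ v) \<le> 2 * cf_size u * cf_size v"
proof -
  have "cf_size (u @ v) = (cf_denom u (cf_map v 0) * cf_denom u (cf_map v 1)) * cf_size v"
    by (simp add: cf_size_def cf_denom_append)
  also have "\<dots> \<le> (2 * cf_size u) * cf_size v"
    using assms cf_size_pos[OF assms(2)]
    by (intro mult_right_mono cf_denom_mult_le_size cf_map_nonneg cf_map_le_1) auto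
  finally show ?thesis .
qed

lemma cf_size_Nil [simp]: "cf_size [] = 1"
  by (simp add: cf_size_def)

lemma cf_size_single [simp]: "cf_size [a] = real (a * (a + 1))"
  by (simp add: cf_size_def field_simps)

lemma cf_size_snoc:
  assumes "a > 0" "\<And>z. 0 \<le> z \<Longrightarrow> cf_denom w z = q + p * z"
  shows "cf_size (w @ [a]) = (q * real a + p) * (q * (real a + 1) + p)"
proof -
  have "cf_denom w (1 / real a) * real a = q * real a + p"
    "cf_denom w (1 / (real a + 1)) * (real a + 1) = q * (real a + 1) + p"
    using assms(1) by (simp_all add: assms(2) distrib_right)
  then show ?thesis by (simp add: cf_size_def cf_denom_append)
qed

text \<open>The worst digit is 1, where (q + p) (2 q + p) is at least twice q (q + p).\<close>

lemma cf_size_snoc_ge: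
  assumes "0 \<notin> set w" "a > 0"
  shows "cf_size (w @ [a]) \<ge> 2 * cf_size w"
proof -
  obtain p q where pq: "0 \<le> p" "p \<le> q" "1 \<le> q" "\<And>z. 0 \<le> z \<Longrightarrow> cf_denom w z = q + p * z"
    using cf_denom_affine[OF assms(1)] by blast
  have a: "real a \<ge> 1" using assms by (cases a) auto
  have "cf_size (w @ [a]) = (q * real a + p) * (q * (real a + 1) + p)"
    using a pq(4) by (intro cf_size_snoc) auto
  moreover have "q * 1 \<le> q * real a" "q * 2 \<le> q * (real a + 1)"
    using a pq by (intro mult_left_mono; auto)+
  then have "(q * 1 + p) * (q * 2 + 0) \<le> (q * real a + p) * (q * (real a + 1) + p)"
    using a pq by (intro mult_mono add_mono) auto
  ultimately show ?thesis using pq by (simp add: cf_size_def algebra_simps)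
qed

lemma cf_size_ge: "0 \<notin> set w \<Longrightarrow> 2 ^ length w \<le> cf_size w"
proof (induction w rule: rev_induct)
  case (snoc a w)
  then show ?case using cf_size_snoc_ge[of w a] by auto
qed simp

text \<open>The digits above \<open>M\<close> occupy at most the proportion \<open>2 / (M + 2)\<close> of every fundamental interval.\<close>

lemma sum_inverse_cf_size_snoc:
  assumes "0 \<notin> set w"
  shows "(\<Sum>a=1..M. 1 / cf_size (w @ [a])) \<ge> real M / (real M + 2) * (1 / cf_size w)"
proof -
  obtain p q where pq: "0 \<le> p" "p \<le> q" "1 \<le> q" "\<And>z. 0 \<le> z \<Longrightarrow> cf_denom w z = q + p * z"
    using cf_denom_affine[OF assms(1)] by blast
  \<comment> \<open>Partial fractions make the sum over the last digit telescope.\<close>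
  have sz: "1 / cf_size (w @ [a]) = 1 / q * (1 / (q * real a + p) - 1 / (q * (real a + 1) + p))"
    if "a \<ge> 1" for a
  proof -
    have "cf_size (w @ [a]) = (q * real a + p) * (q * (real a + 1) + p)"
      using that pq(4) by (intro cf_size_snoc) auto
    moreover have "q * real a + p > 0" "q * (real a + 1) + p > 0"
      using that pq by (auto intro!: add_pos_nonneg mult_pos_pos)
    ultimately show ?thesis using pq by (simp add: field_simps)
  qed
  have tel: "(\<Sum>a=1..M. 1 / (q * real a + p) - 1 / (q * (real a + 1) + p)) =
      1 / (q + p) - 1 / (q * (real M + 1) + p)"
    by (induction M) (auto simp: algebra_simps)
  have D: "q + p > 0" "q * (real M + 1) + p > 0"
    using pq by (simp_all add: add_pos_nonneg)
  have "(\<Sum>a=1..M. 1 / cf_size (w @ [a])) = (\<Sum>a=1..M. 1 / q * (1 / (q * real a + p) - 1 / (q * (real a + 1) + p)))"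
    by (intro sum.cong refl sz) auto
  also have "\<dots> = 1 / q * (1 / (q + p) - 1 / (q * (real M + 1) + p))"
    unfolding sum_distrib_left[symmetric] tel ..
  also have "\<dots> = real M * q / (q * (real M + 1) + p) * (1 / (q * (q + p)))"
  proof -
    have "1 / (q + p) - 1 / (q * (real M + 1) + p) = (q * real M) / ((q + p) * (q * (real M + 1) + p))"
      using D by (simp add: diff_frac_eq algebra_simps)
    moreover have "1 / q * (q * m / (u * v)) = m * q / v * (1 / (q * u))" for m u v :: real
      by (simp add: mult_ac)
    ultimately show ?thesis by (simp only:)
  qed
  also have "\<dots> \<ge> real M * q / (q * (real M + 2)) * (1 / (q * (q + p)))"
  proof -
    \<comment> \<open>Here p \<le> q makes the retained proportion independent of the word.\<close>
    have "q * (real M + 1) + p \<le> q * (real M + 2)" using pq by (simp add: algebra_simps)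
    then have "real M * q / (q * (real M + 2)) \<le> real M * q / (q * (real M + 1) + p)"
      using D(2) pq(3) by (intro frac_le) auto
    then show ?thesis by (rule mult_right_mono) (use pq in simp)
  qed
  finally show ?thesis using pq by (simp add: cf_size_def)
qed

section \<open>Weighted sums over words with bounded digits\<close>

definition words :: "nat \<Rightarrow> nat \<Rightarrow> nat list set" where
  "words M n = {w. set w \<subseteq> {1..M} \<and> length w = n}"

lemma finite_words: "finite (words M n)"
  unfolding words_def by (rule finite_lists_length_eq) simp

lemma zero_notin_words: "w \<in> words M n \<Longrightarrow> 0 \<notin> set w"
  by (auto simp: words_def)

text \<open>Splits off the last digit, not the first, to match the subdivision of a fundamental
  interval by the next digit in \<open>sum_inverse_cf_size_snoc\<close>.\<close>

lemma words_Suc: "words M (Suc n) = (\<lambda>(w, a). w @ [a]) ` (words M n \<times> {1..M})"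
proof (intro equalityI subsetI)
  fix v assume v: "v \<in> words M (Suc n)"
  then have "v \<noteq> []" by (auto simp: words_def)
  then have "v = butlast v @ [last v]" "set (butlast v) \<subseteq> set v" "last v \<in> set v"
    by (auto dest: in_set_butlastD)
  then show "v \<in> (\<lambda>(w, a). w @ [a]) ` (words M n \<times> {1..M})"
    using v by (intro image_eqI[of _ _ "(butlast v, last v)"]) (auto simp: words_def)
qed (auto simp: words_def)

lemma sum_inverse_cf_size_words:
  "(\<Sum>w\<in>words M n. 1 / cf_size w) \<ge> (real M / (real M + 2)) ^ n"
proof (induction n)
  case 0
  have "words M 0 = {[]}" by (auto simp: words_def)
  then show ?case by simp
next
  case (Suc n)
  have "(real M / (real M + 2)) ^ Suc n \<le> (\<Sum>w\<in>words M n. real M / (real M + 2) * (1 / cf_size w))"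
    unfolding sum_distrib_left[symmetric] power_Suc by (intro mult_left_mono Suc) auto
  also have "\<dots> \<le> (\<Sum>w\<in>words M n. \<Sum>a=1..M. 1 / cf_size (w @ [a]))"
    by (intro sum_mono sum_inverse_cf_size_snoc zero_notin_words)
  also have "\<dots> = (\<Sum>(w, a)\<in>words M n \<times> {1..M}. 1 / cf_size (w @ [a]))"
    by (simp add: sum.cartesian_product)
  also have "\<dots> = (\<Sum>w\<in>words M (Suc n). 1 / cf_size w)"
    unfolding words_Suc by (subst sum.reindex) (auto simp: inj_on_def case_prod_beta)
  finally show ?case .
qed

text \<open>A word of length \<open>n\<close> has an interval of length at most 2^(-n), so lowering
  the exponent from 1 to \<open>s\<close> multiplies every summand by at least 2^(n (1 -
  s)).\<close>

lemma sum_cf_size_powr_words: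
  assumes "s \<le> 1"
  shows "(\<Sum>w\<in>words M n. cf_size w powr (- s)) \<ge> (real M / (real M + 2) * 2 powr (1 - s)) ^ n"
proof -
  have "(real M / (real M + 2) * 2 powr (1 - s)) ^ n = (2 ^ n) powr (1 - s) * (real M / (real M + 2)) ^ n"
    unfolding power_mult_distrib
    by (simp add: powr_realpow[symmetric] powr_powr mult.commute powr_power)
  also have "\<dots> \<le> (2 ^ n) powr (1 - s) * (\<Sum>w\<in>words M n. 1 / cf_size w)"
    by (intro mult_left_mono sum_inverse_cf_size_words) auto
  also have "\<dots> = (\<Sum>w\<in>words M n. (2 ^ n) powr (1 - s) * (1 / cf_size w))"
    by (rule sum_distrib_left)
  also have "\<dots> \<le> (\<Sum>w\<in>words M n. cf_size w powr (- s))"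
  proof (rule sum_mono)
    fix w assume w: "w \<in> words M n"
    have pos: "cf_size w > 0" using w cf_size_pos zero_notin_words by blast
    have "2 ^ n \<le> cf_size w" using cf_size_ge[OF zero_notin_words[OF w]] w by (simp add: words_def)
    then have "(2 ^ n) powr (1 - s) * (1 / cf_size w) \<le> cf_size w powr (1 - s) * (1 / cf_size w)"
      using assms pos by (intro mult_right_mono powr_mono2) auto
    also have "\<dots> = cf_size w powr (- s)"
      using pos by (simp add: powr_diff powr_minus field_simps)
    finally show "(2 ^ n) powr (1 - s) * (1 / cf_size w) \<le> cf_size w powr (- s)" .
  qed
  finally show ?thesis .
qed

text \<open>
  Pigeonhole: the words of length \<open>n\<close> have only linearly many digit sums, so a single digit sum
  retains the exponential growth.
\<close>

lemma words_constant_sum: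
  assumes "s < 1"
  obtains M L S W where "W \<subseteq> words M L" "L \<ge> 1" "\<forall>w\<in>W. sum_list w = S"
    "(\<Sum>w\<in>W. cf_size w powr (- s)) \<ge> K"
proof -
  have "((\<lambda>M::nat. real M / (real M + 2) * 2 powr (1 - s)) \<longlongrightarrow> 1 * 2 powr (1 - s)) at_top"
    by (intro tendsto_intros) real_asymp
  moreover have "1 * 2 powr (1 - s) > (1::real)" using assms by simp
  ultimately have "\<forall>\<^sub>F M in at_top. real M / (real M + 2) * 2 powr (1 - s) > 1"
    by (rule order_tendstoD)
  then obtain M :: nat where M: "real M / (real M + 2) * 2 powr (1 - s) > 1"
    using eventually_happens by force
  define \<rho> where "\<rho> = real M / (real M + 2) * 2 powr (1 - s)"
  have "\<rho> > 1" using M by (simp add: \<rho>_def)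
  \<comment> \<open>There are at most M n + 1 digit sums, so once \<rho>^n exceeds this count times
    \<open>max K 0 + 1\<close>, some class must have weight at least \<open>K\<close>. The maximum
    with 0 covers negative \<open>K\<close>.\<close>
  then have "(\<lambda>n::nat. (max K 0 + 1) * (real M * real n + 1) / \<rho> ^ n) \<longlonglongrightarrow> 0"
    by real_asymp
  then have "\<forall>\<^sub>F n::nat in at_top. (max K 0 + 1) * (real M * real n + 1) / \<rho> ^ n < 1"
    by (rule order_tendstoD) simp
  then obtain L :: nat where L: "(max K 0 + 1) * (real M * real L + 1) / \<rho> ^ L < 1" "L \<ge> 1"
    using eventually_happens[OF eventually_conj[OF _ eventually_ge_at_top[of 1]]] by force
  then have gt: "\<rho> ^ L > (max K 0 + 1) * (real M * real L + 1)" using \<open>\<rho> > 1\<close> by (simp add: field_simps)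
  define W where "W = (\<lambda>S. {w \<in> words M L. sum_list w = S})"
  have sums: "sum_list ` words M L \<subseteq> {0..M * L}"
  proof
    fix S assume "S \<in> sum_list ` words M L"
    then obtain w where w: "w \<in> words M L" "S = sum_list w" by auto
    have "(\<Sum>x\<leftarrow>w. x) \<le> (\<Sum>x\<leftarrow>w. M)" using w by (intro sum_list_mono) (auto simp: words_def)
    then show "S \<in> {0..M * L}" using w by (auto simp: words_def sum_list_triv mult.commute)
  qed
  have "\<exists>S. (\<Sum>w\<in>W S. cf_size w powr (- s)) \<ge> K"
  proof (rule ccontr)
    assume neg: "\<not> ?thesis"
    have "\<rho> ^ L \<le> (\<Sum>w\<in>words M L. cf_size w powr (- s))"
      unfolding \<rho>_def using assms by (intro sum_cf_size_powr_words) auto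
    also have "\<dots> = (\<Sum>S\<in>{0..M * L}. \<Sum>w\<in>W S. cf_size w powr (- s))"
      unfolding W_def by (rule sum.group[symmetric]) (use finite_words sums in auto)
    also have "\<dots> \<le> (\<Sum>S\<in>{0..M * L}. max K 0 + 1)"
      using neg by (intro sum_mono) (smt (verit))
    also have "\<dots> = (max K 0 + 1) * (real M * real L + 1)" by (simp add: algebra_simps)
    finally show False using gt by simp
  qed
  then obtain S where "(\<Sum>w\<in>W S. cf_size w powr (- s)) \<ge> K" ..
  moreover have "W S \<subseteq> words M L" "\<forall>w\<in>W S. sum_list w = S" by (auto simp: W_def)
  ultimately show ?thesis using that L(2) by blast
qed

subsection \<open>Values of infinite continued fractions\<close>

text \<open>In contrast to \<^const>\<open>partial_quotient\<close>, digit sequences are indexed from 0.\<close>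

definition cf_lim :: "(nat \<Rightarrow> nat) \<Rightarrow> real" where
  "cf_lim a = lim (\<lambda>n. cf_map (map a [0..<n]) 0)"

text \<open>By \<open>cf_map_diff\<close> distances shrink by a product of denominators, which is at
  least half of \<open>cf_size w\<close> and hence at least half of 2^n for a word of length
  n.\<close>

lemma cf_map_contraction:
  assumes "0 \<notin> set w" "0 \<le> z" "z \<le> 1" "0 \<le> z'" "z' \<le> 1"
  shows "\<bar>cf_map w z - cf_map w z'\<bar> \<le> 2 * (1 / 2) ^ length w"
proof -
  define D where "D = cf_denom w z * cf_denom w z'"
  have "2 ^ length w \<le> 2 * D"
    using cf_size_ge[OF assms(1)] cf_denom_mult_le_size(2)[OF assms] by (simp add: D_def)
  then have D: "D \<ge> 2 ^ length w / 2" "D > 0" by (auto intro: less_le_trans[of _ "2 ^ length w / 2"])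
  have "\<bar>cf_map w z - cf_map w z'\<bar> * (2 ^ length w / 2) \<le> \<bar>cf_map w z - cf_map w z'\<bar> * D"
    using D by (intro mult_left_mono) auto
  also have "\<dots> = \<bar>z - z'\<bar>" unfolding D_def by (rule cf_map_diff) (use assms in auto)
  also have "\<dots> \<le> 1" using assms by auto
  finally show ?thesis by (simp add: field_simps power_one_over)
qed

text \<open>A longer convergent is the map of the shorter prefix applied to a tail value in [0,1],
  so the contraction estimate yields a Cauchy sequence.\<close>

lemma convergent_cf:
  assumes "\<And>j. a j > 0"
  shows "convergent (\<lambda>n. cf_map (map a [0..<n]) 0)"
proof -
  have diff: "\<bar>cf_map (map a [0..<m]) 0 - cf_map (map a [0..<n]) 0\<bar> \<le> 2 * (1 / 2) ^ n" if "n \<le> m" for n m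
  proof -
    have pos: "0 \<notin> set (map a [k..<l])" for k l using assms by (auto simp: less_irrefl simp flip: neq0_conv)
    have "map a [0..<m] = map a [0..<n] @ map a [n..<m]"
      using that upt_add_eq_append[of 0 n "m - n"] by (simp flip: map_append)
    then have eq: "cf_map (map a [0..<m]) 0 = cf_map (map a [0..<n]) (cf_map (map a [n..<m]) 0)"
      by (simp add: cf_map_append)
    show ?thesis unfolding eq
      using cf_map_contraction[OF pos[of 0 n], of "cf_map (map a [n..<m]) 0" 0]
        cf_map_nonneg[of 0 "map a [n..<m]"] cf_map_le_1[OF pos[of n m], of 0] by simp
  qed
  have "Cauchy (\<lambda>n. cf_map (map a [0..<n]) 0)"
  proof (rule metric_CauchyI)
    fix e :: real assume e: "e > 0"
    have "(\<lambda>n. 2 * (1 / 2 :: real) ^ n) \<longlonglongrightarrow> 2 * 0"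
      by (intro tendsto_intros LIMSEQ_realpow_zero) auto
    then have "\<forall>\<^sub>F n in sequentially. 2 * (1 / 2 :: real) ^ n < e / 2"
      by (rule order_tendstoD) (use e in simp)
    then obtain N where N: "2 * (1 / 2 :: real) ^ N < e / 2"
      using eventually_happens by (metis eventually_sequentially order_refl)
    show "\<exists>M. \<forall>m\<ge>M. \<forall>n\<ge>M. dist (cf_map (map a [0..<m]) 0) (cf_map (map a [0..<n]) 0) < e"
    proof (intro exI allI impI)
      fix m n assume "m \<ge> N" "n \<ge> N"
      then show "dist (cf_map (map a [0..<m]) 0) (cf_map (map a [0..<n]) 0) < e"
        using diff[of N m] diff[of N n] N by (auto simp: dist_real_def)
    qed
  qed
  then show ?thesis by (rule Cauchy_convergent)
qed

context
  fixes a :: "nat \<Rightarrow> nat"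
  assumes pos: "\<And>j. a j > 0"
begin

lemma tendsto_cf_lim: "(\<lambda>n. cf_map (map a [0..<n]) 0) \<longlonglongrightarrow> cf_lim a"
  unfolding cf_lim_def using convergent_cf[of a, OF pos] by (simp add: convergent_LIMSEQ_iff)

lemma cf_lim_nonneg: "cf_lim a \<ge> 0"
  by (rule LIMSEQ_le_const[OF tendsto_cf_lim]) (auto intro: cf_map_nonneg)

end

lemma cf_lim_rec:
  assumes pos: "\<And>j. a j > 0"
  shows "cf_lim a = 1 / (real (a 0) + cf_lim (\<lambda>j. a (Suc j)))"
proof -
  have step: "cf_map (map a [0..<Suc n]) 0 = 1 / (real (a 0) + cf_map (map (\<lambda>j. a (Suc j)) [0..<n]) 0)" for n
    by (simp add: upt_conv_Cons map_Suc_upt[symmetric] comp_def del: upt_Suc)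
  have "real (a 0) + cf_lim (\<lambda>j. a (Suc j)) \<noteq> 0"
    using pos[of 0] cf_lim_nonneg[of "\<lambda>j. a (Suc j)"] pos by (auto simp: add_nonneg_eq_0_iff)
  then have "(\<lambda>n. cf_map (map a [0..<Suc n]) 0) \<longlonglongrightarrow> 1 / (real (a 0) + cf_lim (\<lambda>j. a (Suc j)))"
    unfolding step using pos by (intro tendsto_intros tendsto_cf_lim) auto
  moreover have "(\<lambda>n. cf_map (map a [0..<Suc n]) 0) \<longlonglongrightarrow> cf_lim a"
    by (rule LIMSEQ_Suc[OF tendsto_cf_lim[OF pos]])
  ultimately show ?thesis using LIMSEQ_unique by blast
qed

lemma cf_lim_bounds:
  assumes pos: "\<And>j. a j > 0"
  shows "0 < cf_lim a" "cf_lim a < 1"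
proof -
  have gt0: "cf_lim b > 0" if "\<And>j. b j > 0" for b
    using cf_lim_rec[of b] that cf_lim_nonneg[of "\<lambda>j. b (Suc j)"] that[of 0]
    by (auto intro!: divide_pos_pos add_pos_nonneg)
  show "0 < cf_lim a" by (rule gt0[OF pos])
  have "real (a 0) \<ge> 1" using pos[of 0] by simp
  then show "cf_lim a < 1"
    using cf_lim_rec[of a] pos gt0[of "\<lambda>j. a (Suc j)"] by simp
qed

lemma cf_lim_eq_cf_map:
  assumes pos: "\<And>j. a j > 0"
  shows "cf_lim a = cf_map (map a [0..<n]) (cf_lim (\<lambda>j. a (n + j)))"
proof (induction n)
  case (Suc n)
  show ?case
    using Suc cf_lim_rec[of "\<lambda>j. a (n + j)"] pos by (simp add: cf_map_append)
qed simp

text \<open>The tail value lies strictly between 0 and 1, so floor and fractional part of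
  \<open>1 / cf_lim a\<close> undo \<open>cf_lim_rec\<close>.\<close>

lemma cf_lim_floor:
  assumes pos: "\<And>j. a j > 0"
  shows "nat \<lfloor>1 / cf_lim a\<rfloor> = a 0" "gauss_map (cf_lim a) = cf_lim (\<lambda>j. a (Suc j))"
proof -
  have "1 / cf_lim a = real (a 0) + cf_lim (\<lambda>j. a (Suc j))"
    using cf_lim_rec[of a, OF pos] by simp
  moreover have "0 < cf_lim (\<lambda>j. a (Suc j))" "cf_lim (\<lambda>j. a (Suc j)) < 1"
    using cf_lim_bounds[of "\<lambda>j. a (Suc j)"] pos by auto
  moreover from calculation have "\<lfloor>1 / cf_lim a\<rfloor> = int (a 0)" by linarith
  ultimately show "nat \<lfloor>1 / cf_lim a\<rfloor> = a 0" "gauss_map (cf_lim a) = cf_lim (\<lambda>j. a (Suc j))"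
    by (auto simp: gauss_map_def frac_def)
qed

lemma gauss_map_funpow_cf_lim:
  assumes pos: "\<And>j. a j > 0"
  shows "(gauss_map ^^ n) (cf_lim a) = cf_lim (\<lambda>j. a (n + j))"
proof (induction n)
  case (Suc n)
  then show ?case using cf_lim_floor(2)[of "\<lambda>j. a (n + j)"] pos by simp
qed simp

lemma partial_quotient_cf_lim:
  assumes pos: "\<And>j. a j > 0"
  shows "partial_quotient (cf_lim a) (Suc j) = a j"
  using gauss_map_funpow_cf_lim[of a, OF pos] cf_lim_floor(1)[of "\<lambda>i. a (j + i)"] pos
  by (simp add: partial_quotient_def)

lemma quotient_sum_cf_lim:
  assumes pos: "\<And>j. a j > 0"
  shows "quotient_sum n (cf_lim a) = (\<Sum>j<n. a j)"
  unfolding quotient_sum_def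
  by (induction n) (auto simp: partial_quotient_cf_lim[of a, OF pos])

text \<open>Infinite descent along Euclid's algorithm: if the value is m / n, the shifted sequence
  has the value (n - a 0 * m) / m, and m < n because the value is below 1.\<close>

lemma cf_lim_irrational:
  assumes pos: "\<And>j. a j > 0"
  shows "cf_lim a \<notin> \<rat>"
proof -
  have no: "\<forall>j. a j > 0 \<Longrightarrow> cf_lim a \<noteq> real m / real n" for m n a
  proof (induction n arbitrary: a m rule: less_induct)
    case (less n)
    then have pos: "\<And>j. a j > 0" by blast
    show ?case
    proof
      assume eq: "cf_lim a = real m / real n"
      define t where "t = cf_lim (\<lambda>j. a (Suc j))"
      have "0 < m" "0 < n" using cf_lim_bounds(1)[of a, OF pos] eq by (auto intro!: Nat.gr0I)
      then have "m < n" using cf_lim_bounds(2)[of a, OF pos] eq by simp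
      have "1 / cf_lim a = real (a 0) + t"
        using cf_lim_rec[of a, OF pos] by (simp add: t_def)
      then have "real n / real m = real (a 0) + t" using eq by simp
      then have t: "t = (real n - real (a 0 * m)) / real m"
        using \<open>0 < m\<close> by (simp add: field_simps)
      have "t > 0" unfolding t_def by (rule cf_lim_bounds) (rule pos)
      then have "real n - real (a 0 * m) > 0" using t \<open>0 < m\<close> by (simp add: zero_less_divide_iff)
      then have "a 0 * m < n" by linarith
      then have "t = real (n - a 0 * m) / real m" unfolding t by (subst of_nat_diff) auto
      then show False using less.IH[OF \<open>m < n\<close>, of "\<lambda>j. a (Suc j)"] pos by (auto simp: t_def)
    qed
  qed
  show ?thesis
  proof
    assume "cf_lim a \<in> \<rat>"
    then obtain m n where "\<bar>cf_lim a\<bar> = real m / real n" by (rule Rats_abs_nat_div_natE)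
    then show False using no[of a m n] cf_lim_nonneg[of a, OF pos] pos by simp
  qed
qed

text \<open>
  The condition on the digits after the first difference keeps the two tails from approaching the
  endpoint shared by the neighbouring fundamental intervals from both sides.
\<close>

lemma cf_lim_separation:
  assumes pos: "\<And>j. a j > 0" "\<And>j. a' j > 0"
    and eq: "\<And>j. j < n \<Longrightarrow> a j = a' j" and ne: "a n \<noteq> a' n"
    and le: "a n \<le> M" "a' n \<le> M"
    and nxt: "a (Suc n) = a' (Suc n) \<or> a (Suc n) \<le> M \<and> a' (Suc n) \<le> M"
  shows "1 / (2 * (real M + 1) ^ 3) / cf_size (map a [0..<n]) \<le> \<bar>cf_lim a - cf_lim a'\<bar>"
proof -
  define w where "w = map a [0..<n]"
  define z z' where "z = cf_lim (\<lambda>j. a (n + j))" and "z' = cf_lim (\<lambda>j. a' (n + j))"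
  define y y' where "y = cf_lim (\<lambda>j. a (Suc n + j))" and "y' = cf_lim (\<lambda>j. a' (Suc n + j))"
  define t t' where "t = cf_lim (\<lambda>j. a (Suc (Suc n) + j))" and "t' = cf_lim (\<lambda>j. a' (Suc (Suc n) + j))"
  have M: "real M \<ge> 1" using pos(1)[of n] le(1) by simp
  have w: "0 \<notin> set w" using pos(1) by (auto simp: w_def simp flip: neq0_conv)
  have z: "z = 1 / (real (a n) + y)" "z' = 1 / (real (a' n) + y')"
    using cf_lim_rec[of "\<lambda>j. a (n + j)"] cf_lim_rec[of "\<lambda>j. a' (n + j)"] pos
    by (auto simp: z_def z'_def y_def y'_def)
  have y: "y = 1 / (real (a (Suc n)) + t)" "y' = 1 / (real (a' (Suc n)) + t')"
    using cf_lim_rec[of "\<lambda>j. a (Suc n + j)"] cf_lim_rec[of "\<lambda>j. a' (Suc n + j)"] pos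
    by (auto simp: y_def y'_def t_def t'_def)
  have y01: "0 < y" "y < 1" "0 < y'" "y' < 1" and t01: "0 < t" "t < 1" "0 < t'" "t' < 1"
    and z01: "0 < z" "z < 1" "0 < z'" "z' < 1"
    unfolding y_def y'_def t_def t'_def z_def z'_def by (intro cf_lim_bounds pos)+
  have anpos: "real (a n) \<ge> 1" "real (a' n) \<ge> 1" "real (a (Suc n)) \<ge> 1" "real (a' (Suc n)) \<ge> 1"
    using pos(1)[of n] pos(2)[of n] pos(1)[of "Suc n"] pos(2)[of "Suc n"] by auto
  \<comment> \<open>The difference of the digits is at least 1 and could be nearly cancelled only by
    tails near 0 and near 1. Equal next digits confine both tails to an interval of length at most
    1/2; otherwise both tails are at least 1 / (M + 1).\<close>
  have yy: "\<bar>y - y'\<bar> \<le> 1 - 1 / (real M + 1)"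
  proof (cases "a (Suc n) = a' (Suc n)")
    case True
    define b where "b = real (a (Suc n))"
    have b: "b \<ge> 1" using anpos by (simp add: b_def)
    have "1 / (b + 1) \<le> y" "y \<le> 1 / b" "1 / (b + 1) \<le> y'" "y' \<le> 1 / b"
      using y t01 True b by (auto simp: b_def intro!: divide_left_mono)
    then have "\<bar>y - y'\<bar> \<le> 1 / b - 1 / (b + 1)" by linarith
    also have "\<dots> = 1 / (b * (b + 1))" using b by (simp add: field_simps)
    also have "\<dots> \<le> 1 / (1 * (1 + 1))" using b by (intro divide_left_mono mult_mono) auto
    also have "\<dots> \<le> 1 - 1 / (real M + 1)" using M by (simp add: field_simps)
    finally show ?thesis .
  next
    case False
    then have "real (a (Suc n)) \<le> real M" "real (a' (Suc n)) \<le> real M" using nxt by auto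
    then have "1 / (real M + 1) \<le> y" "1 / (real M + 1) \<le> y'"
      using y t01 anpos by (auto intro!: divide_left_mono)
    then show ?thesis using y01 by linarith
  qed
  have "\<bar>real (a n) - real (a' n)\<bar> \<ge> 1" using ne by linarith
  then have num: "\<bar>(real (a' n) + y') - (real (a n) + y)\<bar> \<ge> 1 / (real M + 1)" using yy by linarith
  have zge: "z \<ge> 1 / (real M + 1)" "z' \<ge> 1 / (real M + 1)"
    unfolding z using le y01 anpos by (auto intro!: divide_left_mono)
  \<comment> \<open>One factor of the cube bounds the difference of the denominators, the other two
    bound \<open>z\<close> and \<open>z'\<close>.\<close>
  have "1 / (real M + 1) ^ 3 = 1 / (real M + 1) * (1 / (real M + 1) * (1 / (real M + 1)))"
    by (simp add: power3_eq_cube)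
  also have "\<dots> \<le> \<bar>(real (a' n) + y') - (real (a n) + y)\<bar> * (z * z')"
    using num zge z01 M by (intro mult_mono) auto
  also have "\<dots> = \<bar>z - z'\<bar>"
  proof -
    have "real (a n) + y > 0" "real (a' n) + y' > 0" using y01 anpos by auto
    then have "z - z' = ((real (a' n) + y') - (real (a n) + y)) * (z * z')"
      by (simp add: z field_simps)
    then show ?thesis using z01 by (simp add: abs_mult)
  qed
  finally have zz: "1 / (real M + 1) ^ 3 \<le> \<bar>z - z'\<bar>" .
  have w': "map a' [0..<n] = w" unfolding w_def by (intro map_cong) (simp_all add: eq)
  have X: "cf_lim a = cf_map w z" "cf_lim a' = cf_map w z'"
    using cf_lim_eq_cf_map[of a n, OF pos(1)] cf_lim_eq_cf_map[of a' n, OF pos(2)]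
    unfolding w' w_def[symmetric] z_def z'_def by auto
  have "\<bar>z - z'\<bar> = \<bar>cf_lim a - cf_lim a'\<bar> * (cf_denom w z * cf_denom w z')"
    unfolding X by (rule cf_map_diff[symmetric]) (use w z01 in auto)
  also have "\<dots> \<le> \<bar>cf_lim a - cf_lim a'\<bar> * (2 * cf_size w)"
    using w z01 by (intro mult_left_mono cf_denom_mult_le_size) auto
  finally have "1 / (real M + 1) ^ 3 \<le> \<bar>cf_lim a - cf_lim a'\<bar> * 2 * cf_size w" using zz by simp
  then show ?thesis using cf_size_pos[OF w] unfolding w_def[symmetric] by (simp add: field_simps)
qed

subsection \<open>Mass distribution principle\<close>

text \<open>The mass lives on a parameter space and is carried to \<open>X\<close> by
  \<open>f\<close>. For t < s, a cover of t-weight below 1 / C would, by countable subadditivity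
  over the sets \<open>V\<close>, give the whole space mass below 1.\<close>

lemma hausdorff_dim_geI:
  fixes f :: "'b \<Rightarrow> 'a::metric_space"
  assumes "prob_space N" "0 < C"
    and X: "\<And>\<omega>. \<omega> \<in> space N \<Longrightarrow> f \<omega> \<in> X"
    and V: "\<And>U. bounded U \<Longrightarrow> \<exists>V\<in>sets N. {\<omega> \<in> space N. f \<omega> \<in> U} \<subseteq> V \<and>
              emeasure N V \<le> ennreal (C * diameter U powr s)"
  shows "ereal s \<le> hausdorff_dim X"
  unfolding hausdorff_dim_def
proof (rule INF_greatest)
  fix t assume "t \<in> {t. 0 \<le> t \<and> hausdorff_measure t X = 0}"
  then have t: "0 \<le> t" "hausdorff_measure t X = 0" by auto
  have "\<not> t < s"
  proof
    assume "t < s"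
    \<comment> \<open>The scale 1 suffices: for diameters at most 1 the smaller exponent gives the
      larger power.\<close>
    have "hausdorff_premeasure t 1 X \<le> hausdorff_measure t X"
      unfolding hausdorff_measure_def by (rule SUP_upper) simp
    then have "hausdorff_premeasure t 1 X < ennreal (1 / C)" using t \<open>0 < C\<close> by simp
    then obtain U where U: "X \<subseteq> (\<Union>i. U i)" "\<And>i. bounded (U i)" "\<And>i. diameter (U i) \<le> 1"
      and less: "(\<Sum>i. diameter_weight t (U i)) < ennreal (1 / C)"
      unfolding hausdorff_premeasure_def by (auto simp: INF_less_iff)
    have "\<forall>i. \<exists>V. V \<in> sets N \<and> {\<omega> \<in> space N. f \<omega> \<in> U i} \<subseteq> V \<and>
        emeasure N V \<le> ennreal (C * diameter (U i) powr s)"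
      using V[OF U(2)] unfolding Bex_def by (rule allI)
    from choice[OF this] obtain V where all: "\<forall>i. V i \<in> sets N \<and>
        {\<omega> \<in> space N. f \<omega> \<in> U i} \<subseteq> V i \<and>
        emeasure N (V i) \<le> ennreal (C * diameter (U i) powr s)" by (rule exE)
    have V': "V i \<in> sets N" "{\<omega> \<in> space N. f \<omega> \<in> U i} \<subseteq> V i"
      "emeasure N (V i) \<le> ennreal (C * diameter (U i) powr s)" for i
      using spec[OF all, of i] by auto
    have wt: "ennreal (diameter (U i) powr s) \<le> diameter_weight t (U i)" for i
    proof (cases "U i = {}")
      case False
      then have "diameter (U i) powr s \<le> diameter (U i) powr t \<or> diameter (U i) = 0"
        using U(3)[of i] diameter_ge_0[OF U(2)[of i]] \<open>t < s\<close> powr_mono'[of t s "diameter (U i)"] by auto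
      \<comment> \<open>For t = 0 a nonempty set has weight 1, and this bound settles that
        case.\<close>
      moreover have "diameter (U i) powr s \<le> 1"
        using U(3)[of i] diameter_ge_0[OF U(2)[of i]] \<open>t < s\<close> \<open>0 \<le> t\<close> by (intro powr_le1) auto
      ultimately show ?thesis using False \<open>t < s\<close> \<open>0 \<le> t\<close>
        by (auto simp: diameter_weight_def ennreal_le_1 intro!: ennreal_leI)
    qed simp
    have "space N \<subseteq> (\<Union>i. V i)"
      using X U(1) V'(2) by blast
    then have "1 \<le> emeasure N (\<Union>i. V i)"
      using emeasure_mono[of "space N" "\<Union>i. V i" N] V'(1) prob_space.emeasure_space_1[OF assms(1)] by auto
    also have "\<dots> \<le> (\<Sum>i. emeasure N (V i))"
      using V'(1) by (intro emeasure_subadditive_countably) auto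
    also have "\<dots> \<le> (\<Sum>i. ennreal C * diameter_weight t (U i))"
    proof (intro suminf_le summableI)
      fix i
      have "emeasure N (V i) \<le> ennreal C * ennreal (diameter (U i) powr s)"
        using V'(3)[of i] \<open>0 < C\<close> by (simp add: ennreal_mult)
      also have "\<dots> \<le> ennreal C * diameter_weight t (U i)" by (intro mult_left_mono wt) simp
      finally show "emeasure N (V i) \<le> ennreal C * diameter_weight t (U i)" .
    qed
    also have "\<dots> = ennreal C * (\<Sum>i. diameter_weight t (U i))" by (rule ennreal_suminf_cmult)
    also have "\<dots> < ennreal C * ennreal (1 / C)"
      using less \<open>0 < C\<close> by (intro ennreal_mult_strict_left_mono) auto
    also have "\<dots> = 1" using \<open>0 < C\<close> by (simp flip: ennreal_mult)
    finally show False by simp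
  qed
  then show "ereal s \<le> ereal t" by simp
qed

subsection \<open>Sparse large digits\<close>

text \<open>
  The large value \<open>i\<^sup>2\<close> is inserted greedily, whenever the past sums and products leave room for it;
  since both budgets grow faster than what runs of ones consume, this happens infinitely often.
\<close>

lemma sparse_large_digits:
  obtains b :: "nat \<Rightarrow> nat" where "\<And>i. b i > 0" "\<And>n. (\<Prod>i<n. b i * (b i + 1)) \<le> 4 ^ n"
    "\<And>N. \<exists>i\<ge>N. b i = i\<^sup>2 \<and> (\<Sum>j<i. b j) \<le> 2 * i"
proof -
  \<comment> \<open>\<sigma> and \<pi> are the sum of the b j and the product of the b j (b j + 1)
    over j < i; \<open>0 < i\<close> keeps the digit \<open>i\<^sup>2\<close> positive.\<close>
  define room :: "nat \<Rightarrow> nat \<Rightarrow> nat \<Rightarrow> bool" where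
    "room = (\<lambda>i \<sigma> \<pi>. 0 < i \<and> \<sigma> \<le> 2 * i \<and> \<pi> * (i\<^sup>2 * (i\<^sup>2 + 1)) \<le> 4 ^ Suc i)"
  define next_digit where "next_digit = (\<lambda>i (\<sigma>, \<pi>). if room i \<sigma> \<pi> then i\<^sup>2 else 1)"
  define state :: "nat \<Rightarrow> nat \<times> nat" where
    "state = rec_nat (0, 1) (\<lambda>i p. (fst p + next_digit i p, snd p * (next_digit i p * (next_digit i p + 1))))"
  define b where "b = (\<lambda>i. next_digit i (state i))"
  have state: "state i = (\<Sum>j<i. b j, \<Prod>j<i. b j * (b j + 1))" for i
    by (induction i) (simp_all add: state_def b_def)
  define free where "free = (\<lambda>i. room i (\<Sum>j<i. b j) (\<Prod>j<i. b j * (b j + 1)))"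
  have b: "b i = (if free i then i\<^sup>2 else 1)" for i
  proof -
    have "b i = next_digit i (state i)" by (simp add: b_def)
    then show ?thesis unfolding state by (simp add: next_digit_def free_def)
  qed
  have free: "0 < i" "(\<Sum>j<i. b j) \<le> 2 * i" if "free i" for i
    using that by (simp_all add: free_def room_def)
  have pos: "b i > 0" for i using free(1)[of i] by (simp add: b)
  have prod: "(\<Prod>i<n. b i * (b i + 1)) \<le> 4 ^ n" for n
  proof (induction n)
    case (Suc n)
    show ?case
    proof (cases "free n")
      case True
      then show ?thesis unfolding prod.lessThan_Suc b[of n] by (simp add: free_def room_def)
    next
      case False
      then show ?thesis using Suc unfolding prod.lessThan_Suc b[of n] by simp
    qed
  qed simp
  have often: "\<exists>i\<ge>N. free i" for N
  proof (rule ccontr)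
    assume none: "\<not> ?thesis"
    \<comment> \<open>From here on every step adds 1 to the sum and doubles the product, while the
      budgets grow by 2 and by a factor 4.\<close>
    then have one: "b (N + k) = 1" for k by (simp add: b)
    define \<sigma> \<pi> where "\<sigma> = (\<Sum>j<N. b j)" and "\<pi> = (\<Prod>j<N. b j * (b j + 1))"
    have sum: "(\<Sum>j<N + k. b j) = \<sigma> + k" for k
      by (induction k) (simp_all add: \<sigma>_def one)
    have prod: "(\<Prod>j<N + k. b j * (b j + 1)) = \<pi> * 2 ^ k" for k
      by (induction k) (simp_all add: \<pi>_def one)
    have "(\<lambda>k. real \<pi> * 2 ^ k * ((real N + real k)\<^sup>2 * ((real N + real k)\<^sup>2 + 1)) / (4 ^ Suc N * 4 ^ k)) \<longlonglongrightarrow> 0"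
      by real_asymp
    then have "\<forall>\<^sub>F k in sequentially.
        real \<pi> * 2 ^ k * ((real N + real k)\<^sup>2 * ((real N + real k)\<^sup>2 + 1)) / (4 ^ Suc N * 4 ^ k) < 1"
      by (rule order_tendstoD) simp
    \<comment> \<open>k > \<sigma> meets the sum budget, the strict inequality the product
      budget.\<close>
    from eventually_happens[OF eventually_conj[OF this eventually_ge_at_top[of "Suc \<sigma>"]]]
    obtain k where k: "k \<ge> Suc \<sigma>"
      "real \<pi> * 2 ^ k * ((real N + real k)\<^sup>2 * ((real N + real k)\<^sup>2 + 1)) / (4 ^ Suc N * 4 ^ k) < 1"
      by auto
    then have "real \<pi> * 2 ^ k * ((real N + real k)\<^sup>2 * ((real N + real k)\<^sup>2 + 1)) \<le> 4 ^ Suc (N + k)"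
      by (simp add: power_add)
    then have "real (\<pi> * 2 ^ k * ((N + k)\<^sup>2 * ((N + k)\<^sup>2 + 1))) \<le> real (4 ^ Suc (N + k))"
      by (simp add: algebra_simps)
    then have "free (N + k)"
      unfolding free_def room_def sum prod using k(1) by (simp only: of_nat_le_iff) simp
    then show False using none by simp
  qed
  have "\<exists>i\<ge>N. b i = i\<^sup>2 \<and> (\<Sum>j<i. b j) \<le> 2 * i" for N
    using often[of N] free(2) b by metis
  then show ?thesis using that pos prod by blast
qed

subsection \<open>Block codings\<close>

lemma cf_size_prefix_le:
  assumes "0 \<notin> set (u @ v)"
  shows "cf_size u \<le> cf_size (u @ v)"
  using assms
proof (induction v rule: rev_induct)
  case (snoc a v)
  have pos: "0 \<notin> set (u @ v)" "a > 0" using snoc.prems by auto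
  then have "2 * cf_size (u @ v) \<le> cf_size ((u @ v) @ [a])" "0 < cf_size (u @ v)"
    using cf_size_snoc_ge cf_size_pos by blast+
  then show ?case using snoc.IH[OF pos(1)] by simp
qed simp

locale block_code =
  fixes M L S :: nat and W :: "nat list set" and b :: "nat \<Rightarrow> nat"
  assumes W: "W \<subseteq> words M L" and sum_W: "\<And>w. w \<in> W \<Longrightarrow> sum_list w = S"
    and L: "L \<ge> 1" and b_pos: "\<And>i. b i > 0"
begin

text \<open>Each block consists of the prescribed digit \<open>b i\<close> followed by the freely chosen word \<open>\<omega> i\<close>.\<close>

definition digits :: "(nat \<Rightarrow> nat list) \<Rightarrow> nat \<Rightarrow> nat" where
  "digits \<omega> n = (b (n div Suc L) # \<omega> (n div Suc L)) ! (n mod Suc L)"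

abbreviation seqs :: "(nat \<Rightarrow> nat list) set" where
  "seqs \<equiv> {\<omega>. \<forall>i. \<omega> i \<in> W}"

lemma length_block: "\<omega> \<in> seqs \<Longrightarrow> length (\<omega> i) = L"
  using W by (auto simp: words_def)

lemma block_digit_bounds:
  assumes "\<omega> \<in> seqs" "k < L"
  shows "0 < \<omega> i ! k" "\<omega> i ! k \<le> M"
proof -
  have "\<omega> i \<in> words M L" using W assms(1) by blast
  then have "length (\<omega> i) = L" "set (\<omega> i) \<subseteq> {1..M}" by (auto simp: words_def)
  then have "\<omega> i ! k \<in> {1..M}" using assms(2) nth_mem[of k "\<omega> i"] by blast
  then show "0 < \<omega> i ! k" "\<omega> i ! k \<le> M" by auto
qed

lemma digits_block_start: "digits \<omega> (B * Suc L) = b B"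
  by (simp add: digits_def del: mult_Suc_right)

lemma digits_block:
  assumes "k \<le> L"
  shows "digits \<omega> (B * Suc L + k) = (b B # \<omega> B) ! k"
proof -
  have "(B * Suc L + k) div Suc L = B" "(B * Suc L + k) mod Suc L = k"
    using assms by (simp_all del: mult_Suc_right)
  then show ?thesis by (simp only: digits_def)
qed

lemma digits_pos:
  assumes "\<omega> \<in> seqs"
  shows "digits \<omega> n > 0"
proof -
  have "n mod Suc L < Suc L" by simp
  then show ?thesis
    using block_digit_bounds(1)[OF assms, of "n mod Suc L - 1"] b_pos
    by (cases "n mod Suc L") (auto simp: digits_def)
qed

lemma take_block:
  assumes "\<omega> \<in> seqs" "j \<le> Suc L"
  shows "map (digits \<omega>) [B * Suc L..<B * Suc L + j] = take j (b B # \<omega> B)"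
proof (rule nth_equalityI)
  show "length (map (digits \<omega>) [B * Suc L..<B * Suc L + j]) = length (take j (b B # \<omega> B))"
    using assms(2) length_block[OF assms(1), of B] by (simp del: mult_Suc_right)
next
  fix k assume "k < length (map (digits \<omega>) [B * Suc L..<B * Suc L + j])"
  then have "k < j" by (simp del: mult_Suc_right)
  then show "map (digits \<omega>) [B * Suc L..<B * Suc L + j] ! k = take j (b B # \<omega> B) ! k"
    using assms(2) digits_block[of k \<omega> B] by (simp del: mult_Suc_right)
qed

lemma prefix_block:
  assumes "\<omega> \<in> seqs" "j \<le> Suc L"
  shows "map (digits \<omega>) [0..<B * Suc L + j] =
    map (digits \<omega>) [0..<B * Suc L] @ take j (b B # \<omega> B)"
  using take_block[OF assms, of B]
  by (simp add: upt_add_eq_append[of 0 "B * Suc L" j] del: mult_Suc_right)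

lemma prefix_Suc_block:
  assumes "\<omega> \<in> seqs"
  shows "map (digits \<omega>) [0..<Suc B * Suc L] = map (digits \<omega>) [0..<B * Suc L] @ (b B # \<omega> B)"
proof -
  have "Suc B * Suc L = B * Suc L + Suc L" by simp
  then show ?thesis
    using prefix_block[OF assms order_refl, of B] length_block[OF assms, of B] by (simp only: take_all length_Cons)
qed

lemma digit_sum_blocks:
  assumes "\<omega> \<in> seqs"
  shows "(\<Sum>j<B * Suc L. digits \<omega> j) = (\<Sum>i<B. b i) + B * S"
proof -
  have "sum_list (map (digits \<omega>) [0..<B * Suc L]) = (\<Sum>i<B. b i) + B * S"
  proof (induction B)
    case (Suc B)
    have "sum_list (\<omega> B) = S" using assms sum_W by blast
    then show ?case unfolding prefix_Suc_block[OF assms] sum_list_append Suc.IH by simp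
  qed simp
  then show ?thesis by (simp only: sum_list_distinct_conv_sum_set distinct_upt set_upt atLeast0LessThan)
qed

text \<open>At the block boundaries the digit sums of all codings agree.\<close>

lemma digit_sum_diff_le:
  assumes "\<omega> \<in> seqs" "\<omega>' \<in> seqs"
  shows "(\<Sum>j<n. digits \<omega> j) \<le> (\<Sum>j<n. digits \<omega>' j) + S"
proof -
  define B j where "B = n div Suc L" and "j = n mod Suc L"
  have n: "n = B * Suc L + j" and j: "j \<le> Suc L"
    using mod_less_divisor[of "Suc L" n] by (auto simp: B_def j_def simp del: mult_Suc_right)
  have eq: "(\<Sum>j<n. digits \<omega> j) = (\<Sum>i<B. b i) + B * S + sum_list (take j (b B # \<omega> B))"
    if "\<omega> \<in> seqs" for \<omega>
  proof -
    have conv: "(\<Sum>j<m. digits \<omega> j) = sum_list (map (digits \<omega>) [0..<m])" for m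
      by (simp only: sum_list_distinct_conv_sum_set distinct_upt set_upt atLeast0LessThan)
    have "(\<Sum>j<n. digits \<omega> j) = (\<Sum>j<B * Suc L. digits \<omega> j) + sum_list (take j (b B # \<omega> B))"
      by (simp only: conv n prefix_block[OF that j] sum_list_append)
    then show ?thesis by (simp only: digit_sum_blocks[OF that])
  qed
  \<comment> \<open>Both partial blocks begin with the same \<open>b B\<close>, and a piece of
    \<open>\<omega> B\<close> sums to at most \<open>S\<close>.\<close>
  have "sum_list (take j (b B # \<omega> B)) \<le> sum_list (take j (b B # \<omega>' B)) + S"
  proof (cases j)
    case (Suc k)
    have "sum_list (take k (\<omega> B)) + sum_list (drop k (\<omega> B)) = sum_list (\<omega> B)"
      by (simp flip: sum_list_append)
    moreover have "sum_list (\<omega> B) = S" using assms sum_W by blast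
    ultimately show ?thesis using Suc by simp
  qed simp
  then show ?thesis using eq[OF assms(1)] eq[OF assms(2)] by simp
qed

lemma zero_notin_prefix:
  assumes "\<omega> \<in> seqs"
  shows "0 \<notin> set (map (digits \<omega>) [m..<n])"
  using digits_pos[OF assms] by (auto simp flip: neq0_conv)

lemma zero_notin_block: "\<omega> \<in> seqs \<Longrightarrow> 0 \<notin> set (\<omega> i)"
  using W zero_notin_words by blast

lemma finite_W: "finite W"
  using W finite_words finite_subset by blast

text \<open>The factor 4 per block comes from two concatenations: of the past with the block, and of
  \<open>b i\<close> with \<open>\<omega> i\<close>.\<close>

lemma cf_size_blocks_le:
  assumes "\<omega> \<in> seqs"
  shows "cf_size (map (digits \<omega>) [0..<B * Suc L]) \<le>
    (\<Prod>i<B. real (b i * (b i + 1))) * (\<Prod>i<B. 4 * cf_size (\<omega> i))"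
proof (induction B)
  case (Suc B)
  define u where "u = map (digits \<omega>) [0..<B * Suc L]"
  have u: "0 \<notin> set u" unfolding u_def by (rule zero_notin_prefix[OF assms])
  have w: "0 \<notin> set (\<omega> B)" by (rule zero_notin_block[OF assms])
  have bw: "0 \<notin> set ([b B] @ \<omega> B)" using w b_pos[of B] by auto
  have "cf_size (u @ ([b B] @ \<omega> B)) \<le> 2 * cf_size u * cf_size ([b B] @ \<omega> B)"
    by (rule cf_size_append_le[OF u bw])
  also have "\<dots> \<le> 2 * cf_size u * (2 * cf_size [b B] * cf_size (\<omega> B))"
    using cf_size_pos[OF u] w b_pos[of B] by (intro mult_left_mono cf_size_append_le) auto
  also have "\<dots> = cf_size u * (real (b B * (b B + 1)) * (4 * cf_size (\<omega> B)))"
    by simp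
  also have "\<dots> \<le> ((\<Prod>i<B. real (b i * (b i + 1))) * (\<Prod>i<B. 4 * cf_size (\<omega> i))) *
      (real (b B * (b B + 1)) * (4 * cf_size (\<omega> B)))"
    using Suc.IH cf_size_pos[OF w] unfolding u_def by (intro mult_right_mono) auto
  also have "\<dots> = (\<Prod>i<Suc B. real (b i * (b i + 1))) * (\<Prod>i<Suc B. 4 * cf_size (\<omega> i))"
    by (simp only: prod.lessThan_Suc mult_ac)
  finally show ?case unfolding prefix_Suc_block[OF assms] u_def by simp
qed simp

end

text \<open>The threshold 16 pays for one block: a factor 4 from the two concatenations and a factor
  4 from the growth allowed to the prescribed digits.\<close>

locale growing_block_code = block_code +
  fixes s :: real
  assumes s: "0 < s" "s \<le> 1"
    and prod_b: "\<And>n. (\<Prod>i<n. b i * (b i + 1)) \<le> 4 ^ n"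
    and weight: "16 \<le> (\<Sum>w\<in>W. cf_size w powr (- s))"
begin

text \<open>An unfinished block changes the size only by a bounded factor: its free part is a prefix
  of one of finitely many words, and its prescribed digit is covered by the product bound.\<close>

lemma cf_size_prefix_le_prod:
  obtains C where "C > 0" "\<And>\<omega> B j. \<omega> \<in> seqs \<Longrightarrow> 1 \<le> j \<Longrightarrow> j \<le> Suc L \<Longrightarrow>
    cf_size (map (digits \<omega>) [0..<B * Suc L + j]) \<le> C * (\<Prod>i<B. 16 * cf_size (\<omega> i))"
proof
  define K where "K = 1 + (\<Sum>w\<in>W. cf_size w)"
  have size_pos: "cf_size w > 0" if "w \<in> W" for w
    using that W zero_notin_words cf_size_pos by blast
  then have K_ge: "K \<ge> 1" unfolding K_def by (simp add: sum_nonneg less_imp_le)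
  then show "16 * K > 0" by simp
  fix \<omega> B j assume \<omega>: "\<omega> \<in> seqs" and j: "1 \<le> j" "j \<le> Suc L"
  define u v where "u = map (digits \<omega>) [0..<B * Suc L]" and "v = take (j - 1) (\<omega> B)"
  have u: "0 \<notin> set u" unfolding u_def by (rule zero_notin_prefix[OF \<omega>])
  have wB: "\<omega> B \<in> W" using \<omega> by blast
  have v: "0 \<notin> set v" using zero_notin_block[OF \<omega>, of B] unfolding v_def by (auto dest: in_set_takeD)
  have bv: "0 \<notin> set ([b B] @ v)" using v b_pos[of B] by auto
  have "cf_size v \<le> cf_size (v @ drop (j - 1) (\<omega> B))"
    using zero_notin_block[OF \<omega>, of B] by (intro cf_size_prefix_le) (simp add: v_def)
  also have "\<dots> = cf_size (\<omega> B)" by (simp add: v_def)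
  also have "\<dots> \<le> K"
    using member_le_sum[of "\<omega> B" W cf_size] wB size_pos finite_W unfolding K_def by (fastforce intro: less_imp_le)
  finally have vK: "cf_size v \<le> K" .
  have "cf_size (u @ ([b B] @ v)) \<le> 2 * cf_size u * cf_size ([b B] @ v)"
    by (rule cf_size_append_le[OF u bv])
  also have "\<dots> \<le> 2 * cf_size u * (2 * cf_size [b B] * cf_size v)"
    using cf_size_pos[OF u] v b_pos[of B] by (intro mult_left_mono cf_size_append_le) auto
  also have "\<dots> \<le> 2 * cf_size u * (2 * cf_size [b B] * K)"
    using cf_size_pos[OF u] vK by (intro mult_left_mono) auto
  also have "\<dots> = (4 * K * real (b B * (b B + 1))) * cf_size u"
    by simp
  also have "\<dots> \<le> (4 * K * real (b B * (b B + 1))) *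
      ((\<Prod>i<B. real (b i * (b i + 1))) * (\<Prod>i<B. 4 * cf_size (\<omega> i)))"
    using K_ge cf_size_blocks_le[OF \<omega>, of B] unfolding u_def by (intro mult_left_mono) auto
  \<comment> \<open>The digit \<open>b B\<close> of the unfinished block joins the earlier
    prescribed digits, so the product bound is applied at \<open>Suc B\<close>.\<close>
  also have "\<dots> = 4 * K * (\<Prod>i<B. 4 * cf_size (\<omega> i)) * real (\<Prod>i<Suc B. b i * (b i + 1))"
    by (simp only: prod.lessThan_Suc of_nat_mult of_nat_prod mult_ac)
  also have "\<dots> \<le> 4 * K * (\<Prod>i<B. 4 * cf_size (\<omega> i)) * real (4 ^ Suc B)"
    using prod_b[of "Suc B"] K_ge size_pos \<omega> by (intro mult_left_mono of_nat_mono mult_nonneg_nonneg prod_nonneg) (auto intro: less_imp_le)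
  also have "\<dots> = 16 * K * (\<Prod>i<B. 16 * cf_size (\<omega> i))"
  proof -
    have "(\<Prod>i<B. 16 * cf_size (\<omega> i)) = (\<Prod>i<B. 4 * (4 * cf_size (\<omega> i)))" by simp
    also have "\<dots> = 4 ^ B * (\<Prod>i<B. 4 * cf_size (\<omega> i))" by (subst prod.distrib) simp
    finally show ?thesis by simp
  qed
  finally show "cf_size (map (digits \<omega>) [0..<B * Suc L + j]) \<le> 16 * K * (\<Prod>i<B. 16 * cf_size (\<omega> i))"
    unfolding prefix_block[OF \<omega> j(2)] u_def v_def using j(1) by (cases j) auto
qed

section \<open>The product measure on codings and its local dimension\<close>

definition prob_word :: "nat list \<Rightarrow> real" where
  "prob_word w = cf_size w powr (- s) / (\<Sum>w\<in>W. cf_size w powr (- s))"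

definition code_measure :: "(nat \<Rightarrow> nat list) measure" where
  "code_measure = (\<Pi>\<^sub>M i\<in>UNIV. point_measure W (\<lambda>w. ennreal (prob_word w)))"

definition cylinder :: "(nat \<Rightarrow> nat list) \<Rightarrow> nat \<Rightarrow> (nat \<Rightarrow> nat list) set" where
  "cylinder \<omega> B = {\<omega>' \<in> seqs. \<forall>i<B. \<omega>' i = \<omega> i}"

lemma space_code_measure: "space code_measure = seqs"
  by (auto simp: code_measure_def space_PiM space_point_measure)

lemma prob_space_word: "prob_space (point_measure W (\<lambda>w. ennreal (prob_word w)))"
proof (rule prob_spaceI)
  have "(\<Sum>w\<in>W. prob_word w) = 1"
    using weight by (simp add: prob_word_def flip: sum_divide_distrib)
  moreover have "prob_word w \<ge> 0" for w
    using weight by (simp add: prob_word_def)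
  ultimately have "(\<Sum>w\<in>W. ennreal (prob_word w)) = 1" by (simp add: sum_ennreal)
  then show "emeasure (point_measure W (\<lambda>w. ennreal (prob_word w)))
      (space (point_measure W (\<lambda>w. ennreal (prob_word w)))) = 1"
    by (simp add: space_point_measure emeasure_point_measure_finite finite_W)
qed

lemma prob_space_code_measure: "prob_space code_measure"
  unfolding code_measure_def by (intro prob_space_PiM prob_space_word)

text \<open>The normalising sum is at least 16 and so at least 16 powr s, which compensates the
  factor 16 lost per block.\<close>

lemma prob_word_le:
  assumes "w \<in> W"
  shows "prob_word w \<le> (16 * cf_size w) powr (- s)"
proof -
  have pos: "cf_size w > 0" using assms W zero_notin_words cf_size_pos by blast
  have "16 powr s \<le> (16 :: real) powr 1" using s by (intro powr_mono) auto
  then have "cf_size w powr (- s) / (\<Sum>w\<in>W. cf_size w powr (- s)) \<le> cf_size w powr (- s) / 16 powr s"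
    using weight by (intro divide_left_mono mult_pos_pos) auto
  also have "\<dots> = (16 * cf_size w) powr (- s)"
    using pos by (simp add: powr_mult powr_minus_divide)
  finally show ?thesis by (simp add: prob_word_def)
qed

text \<open>Blocks are independent, so the mass is a product of word probabilities. The bound is
  phrased with the product that controls prefix sizes in
  \<open>cf_size_prefix_le_prod\<close>.\<close>

lemma cylinder_measure:
  assumes "\<omega> \<in> seqs"
  shows "cylinder \<omega> B \<in> sets code_measure"
    "emeasure code_measure (cylinder \<omega> B) \<le> ennreal ((\<Prod>i<B. 16 * cf_size (\<omega> i)) powr (- s))"
proof -
  let ?P = "point_measure W (\<lambda>w. ennreal (prob_word w))"
  interpret product_prob_space "\<lambda>_::nat. ?P" UNIV
    using prob_space_word
    by (simp add: product_prob_space_def product_prob_space_axioms_def product_sigma_finite_def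
        prob_space_imp_sigma_finite)
  have cyl: "cylinder \<omega> B = {\<omega>' \<in> space code_measure. \<forall>i\<in>{..<B}. \<omega>' i \<in> {\<omega> i}}"
    by (auto simp: cylinder_def space_code_measure)
  have sing: "{\<omega> i} \<in> sets ?P" for i using assms by (auto simp: sets_point_measure)
  show "cylinder \<omega> B \<in> sets code_measure"
    unfolding cyl code_measure_def using sing by measurable
  have nonneg: "prob_word w \<ge> 0" for w using weight by (simp add: prob_word_def)
  have "emeasure code_measure (cylinder \<omega> B) = (\<Prod>i<B. emeasure ?P {\<omega> i})"
    unfolding cyl unfolding code_measure_def by (intro emeasure_PiM_Collect sing) auto
  also have "\<dots> = (\<Prod>i<B. ennreal (prob_word (\<omega> i)))"
    using assms finite_W by (intro prod.cong refl) (subst emeasure_point_measure_finite, auto)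
  also have "\<dots> = ennreal (\<Prod>i<B. prob_word (\<omega> i))" by (simp add: prod_ennreal nonneg)
  also have "\<dots> \<le> ennreal (\<Prod>i<B. (16 * cf_size (\<omega> i)) powr (- s))"
    using assms nonneg by (intro ennreal_leI prod_mono conjI prob_word_le) auto
  also have "(\<Prod>i<B. (16 * cf_size (\<omega> i)) powr (- s)) = (\<Prod>i<B. 16 * cf_size (\<omega> i)) powr (- s)"
    by (rule prod_powr_distrib[symmetric])
  finally show "emeasure code_measure (cylinder \<omega> B) \<le> ennreal ((\<Prod>i<B. 16 * cf_size (\<omega> i)) powr (- s))" .
qed

text \<open>Serves the sets \<open>U\<close> that contain the value of a single coding, whose
  diameter may be 0. Cylinders of depth \<open>B\<close> around \<omega> have mass at most 16^(-s
  B).\<close>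

lemma emeasure_singleton_null:
  assumes "\<omega> \<in> seqs"
  shows "{\<omega>} \<in> sets code_measure" "emeasure code_measure {\<omega>} = 0"
proof -
  have "{\<omega>} = (\<Inter>B. cylinder \<omega> B)"
    using assms by (auto simp: cylinder_def fun_eq_iff) (metis lessI)
  then show "{\<omega>} \<in> sets code_measure"
    using cylinder_measure(1)[OF assms] by auto
  have le: "emeasure code_measure {\<omega>} \<le> ennreal ((16 powr (- s)) ^ B)" for B
  proof -
    have size: "1 \<le> cf_size (\<omega> i)" for i
      using cf_size_ge[OF zero_notin_block[OF assms]] one_le_power[of 2 "length (\<omega> i)"] by (smt (verit))
    have "(\<Prod>i<B. 16) \<le> (\<Prod>i<B. 16 * cf_size (\<omega> i))" using size by (intro prod_mono) auto
    then have "(16 ^ B) \<le> (\<Prod>i<B. 16 * cf_size (\<omega> i))" by simp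
    then have "(\<Prod>i<B. 16 * cf_size (\<omega> i)) powr (- s) \<le> (16 ^ B) powr (- s)"
      using s by (intro powr_mono2') auto
    also have "\<dots> = (16 powr (- s)) ^ B" by (simp add: powr_realpow[symmetric] powr_powr mult.commute powr_power)
    finally have "ennreal ((\<Prod>i<B. 16 * cf_size (\<omega> i)) powr (- s)) \<le> ennreal ((16 powr (- s)) ^ B)"
      by (rule ennreal_leI)
    moreover have "emeasure code_measure {\<omega>} \<le> emeasure code_measure (cylinder \<omega> B)"
      using assms by (intro emeasure_mono cylinder_measure) (auto simp: cylinder_def)
    ultimately show ?thesis using cylinder_measure(2)[OF assms, of B] by (meson order_trans)
  qed
  have "(\<lambda>B. (16 powr (- s)) ^ B) \<longlonglongrightarrow> (0 :: real)"
    using s by (intro LIMSEQ_realpow_zero) (auto simp: powr_minus_divide field_simps)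
  then have "(\<lambda>B. ennreal ((16 powr (- s)) ^ B)) \<longlonglongrightarrow> ennreal 0" by (rule tendsto_ennrealI)
  then have "emeasure code_measure {\<omega>} \<le> ennreal 0" by (rule LIMSEQ_le_const) (use le in auto)
  then show "emeasure code_measure {\<omega>} = 0" by simp
qed

text \<open>Prescribed digits are common to all codings, so the first differing digit is a free one,
  bounded by \<open>M\<close>, as \<open>cf_lim_separation\<close> requires.\<close>

lemma first_difference:
  assumes "\<omega> \<in> seqs" "\<omega>' \<in> seqs" "\<And>i. i < B \<Longrightarrow> \<omega> i = \<omega>' i" "\<omega> B \<noteq> \<omega>' B"
  obtains k where "k < L"
    "1 / (2 * (real M + 1) ^ 3) / cf_size (map (digits \<omega>) [0..<B * Suc L + Suc k])
      \<le> \<bar>cf_lim (digits \<omega>) - cf_lim (digits \<omega>')\<bar>"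
proof -
  have "\<exists>k. k < L \<and> \<omega> B ! k \<noteq> \<omega>' B ! k"
    using assms(4) nth_equalityI[of "\<omega> B" "\<omega>' B"] length_block[OF assms(1)] length_block[OF assms(2)] by auto
  define k where "k = (LEAST k. k < L \<and> \<omega> B ! k \<noteq> \<omega>' B ! k)"
  have k: "k < L" "\<omega> B ! k \<noteq> \<omega>' B ! k"
    using LeastI_ex[OF \<open>\<exists>k. _\<close>] unfolding k_def by auto
  have min: "\<omega> B ! l = \<omega>' B ! l" if "l < k" for l
    using not_less_Least[of l "\<lambda>k. k < L \<and> \<omega> B ! k \<noteq> \<omega>' B ! k"] that k(1) unfolding k_def[symmetric] by auto
  \<comment> \<open>The shift from \<open>k\<close> to \<open>Suc k\<close> accounts for the
    prescribed digit at the head of the block.\<close>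
  define n where "n = B * Suc L + Suc k"
  have here: "digits \<eta> n = \<eta> B ! k" for \<eta>
    using digits_block[of "Suc k" \<eta> B] k(1) by (simp add: n_def)
  have "1 / (2 * (real M + 1) ^ 3) / cf_size (map (digits \<omega>) [0..<n])
      \<le> \<bar>cf_lim (digits \<omega>) - cf_lim (digits \<omega>')\<bar>"
  proof (rule cf_lim_separation)
    show "digits \<omega> j > 0" "digits \<omega>' j > 0" for j using digits_pos assms by auto
    show "digits \<omega> n \<noteq> digits \<omega>' n" using here k by simp
    show "digits \<omega> n \<le> M" "digits \<omega>' n \<le> M"
      using here block_digit_bounds(2)[OF _ k(1)] assms by auto
    show "digits \<omega> j = digits \<omega>' j" if "j < n" for j
    proof (cases "j < B * Suc L")
      case True
      then have "j div Suc L < B" by (simp add: less_mult_imp_div_less)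
      then show ?thesis using assms(3) by (simp add: digits_def)
    next
      case False
      then obtain r where r: "j = B * Suc L + r" by (metis le_add_diff_inverse not_less)
      then have "r \<le> k" using that by (simp add: n_def)
      then show ?thesis using digits_block[of r _ B] r k(1) min by (cases r) auto
    qed
    \<comment> \<open>The next digit is either free, hence at most \<open>M\<close> in both codings,
      or the common prescribed digit of the following block.\<close>
    show "digits \<omega> (Suc n) = digits \<omega>' (Suc n) \<or> digits \<omega> (Suc n) \<le> M \<and> digits \<omega>' (Suc n) \<le> M"
    proof (cases "Suc k < L")
      case True
      have "digits \<eta> (Suc n) = \<eta> B ! Suc k" for \<eta>
        using digits_block[of "Suc (Suc k)" \<eta> B] True by (simp add: n_def)
      then show ?thesis using block_digit_bounds(2)[OF _ True] assms by auto
    next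
      case False
      then have "Suc n = Suc B * Suc L" using k(1) by (simp add: n_def)
      then show ?thesis using digits_block_start by metis
    qed
  qed
  then show ?thesis using that k(1) by (auto simp: n_def)
qed

text \<open>Let \<open>B\<close> be the first block in which two codings with values in
  \<open>U\<close> differ. All codings with values in \<open>U\<close> then lie in one cylinder of
  depth \<open>B\<close>, while separation bounds the diameter of \<open>U\<close> from below by a
  multiple of the reciprocal prefix size.\<close>

lemma hausdorff_dim_code:
  assumes "\<And>\<omega>. \<omega> \<in> seqs \<Longrightarrow> cf_lim (digits \<omega>) \<in> X"
  shows "ereal s \<le> hausdorff_dim X"
proof -
  obtain C where C: "C > 0" "\<And>\<omega> B j. \<omega> \<in> seqs \<Longrightarrow> 1 \<le> j \<Longrightarrow> j \<le> Suc L \<Longrightarrow>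
      cf_size (map (digits \<omega>) [0..<B * Suc L + j]) \<le> C * (\<Prod>i<B. 16 * cf_size (\<omega> i))"
    using cf_size_prefix_le_prod by blast
  \<comment> \<open>\<open>D\<close> joins the prefix constant with the separation constant, so that
    values which first differ in block \<open>B\<close> are at least 1 / (D P) apart, with
    \<open>P\<close> the product for the first \<open>B\<close> blocks.\<close>
  define D where "D = C * (2 * (real M + 1) ^ 3)"
  have "D > 0" using C(1) by (simp add: D_def)
  show ?thesis
  proof (rule hausdorff_dim_geI[where N = code_measure and C = "D powr s" and f = "\<lambda>\<omega>. cf_lim (digits \<omega>)"])
    show "prob_space code_measure" by (rule prob_space_code_measure)
    show "0 < D powr s" using \<open>D > 0\<close> by simp
    show "cf_lim (digits \<omega>) \<in> X" if "\<omega> \<in> space code_measure" for \<omega>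
      using assms that by (simp add: space_code_measure)
    fix U :: "real set" assume U: "bounded U"
    define E where "E = {\<omega> \<in> space code_measure. cf_lim (digits \<omega>) \<in> U}"
    have E: "\<omega> \<in> seqs" if "\<omega> \<in> E" for \<omega> using that by (auto simp: E_def space_code_measure)
    have "\<exists>V\<in>sets code_measure. E \<subseteq> V \<and> emeasure code_measure V \<le> ennreal (D powr s * diameter U powr s)"
    proof (cases "\<exists>B. \<exists>\<omega>\<in>E. \<exists>\<omega>'\<in>E. \<omega> B \<noteq> \<omega>' B")
      case False
      then have one: "\<omega> = \<omega>'" if "\<omega> \<in> E" "\<omega>' \<in> E" for \<omega> \<omega>' using that by (auto simp: fun_eq_iff)
      show ?thesis
      proof (cases "E = {}")
        case False
        then obtain \<omega> where "E = {\<omega>}" using one by blast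
        moreover from this have "\<omega> \<in> seqs" using E by blast
        ultimately show ?thesis using emeasure_singleton_null[of \<omega>] by (intro bexI[of _ "{\<omega>}"]) auto
      qed (auto intro: bexI[of _ "{}"])
    next
      case True
      define B where "B = (LEAST B. \<exists>\<omega>\<in>E. \<exists>\<omega>'\<in>E. \<omega> B \<noteq> \<omega>' B)"
      obtain \<omega> \<omega>' where \<omega>: "\<omega> \<in> E" "\<omega>' \<in> E" "\<omega> B \<noteq> \<omega>' B"
        using LeastI_ex[OF True] unfolding B_def by auto
      have agree: "\<eta> i = \<eta>' i" if "i < B" "\<eta> \<in> E" "\<eta>' \<in> E" for \<eta> \<eta>' i
        using not_less_Least[of i "\<lambda>B. \<exists>\<omega>\<in>E. \<exists>\<omega>'\<in>E. \<omega> B \<noteq> \<omega>' B"] that unfolding B_def by blast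
      define P where "P = (\<Prod>i<B. 16 * cf_size (\<omega> i))"
      have "cf_size (\<omega> i) > 0" for i using cf_size_pos zero_notin_block[OF E[OF \<omega>(1)]] by blast
      then have P: "P > 0" unfolding P_def by (intro prod_pos) auto
      obtain k where k: "k < L" "1 / (2 * (real M + 1) ^ 3) / cf_size (map (digits \<omega>) [0..<B * Suc L + Suc k])
          \<le> \<bar>cf_lim (digits \<omega>) - cf_lim (digits \<omega>')\<bar>"
        using first_difference[OF E[OF \<omega>(1)] E[OF \<omega>(2)], of B] agree \<omega> by blast
      define Q where "Q = cf_size (map (digits \<omega>) [0..<B * Suc L + Suc k])"
      have Q: "0 < Q" "Q \<le> C * P"
        unfolding Q_def P_def using k(1) E[OF \<omega>(1)] by (intro cf_size_pos zero_notin_prefix C; simp)+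
      have "1 / (D * P) = 1 / (2 * (real M + 1) ^ 3) / (C * P)" by (simp add: D_def field_simps)
      also have "\<dots> \<le> 1 / (2 * (real M + 1) ^ 3) / Q"
        using Q P C(1) by (intro divide_left_mono mult_pos_pos) auto
      also have "\<dots> \<le> dist (cf_lim (digits \<omega>)) (cf_lim (digits \<omega>'))"
        using k(2) by (simp add: Q_def dist_real_def)
      also have "\<dots> \<le> diameter U"
        using \<omega> U by (intro diameter_bounded_bound) (auto simp: E_def)
      finally have "1 / P \<le> D * diameter U" using P \<open>D > 0\<close> by (simp add: field_simps)
      then have "(1 / P) powr s \<le> (D * diameter U) powr s"
        using P s by (intro powr_mono2) auto
      then have bound: "P powr (- s) \<le> D powr s * diameter U powr s"
        using P \<open>D > 0\<close> diameter_ge_0[OF U] by (simp add: powr_divide powr_minus_divide powr_mult)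
      show ?thesis
      proof (intro bexI conjI)
        show "cylinder \<omega> B \<in> sets code_measure" by (rule cylinder_measure[OF E[OF \<omega>(1)]])
        show "E \<subseteq> cylinder \<omega> B" using E agree \<omega>(1) by (auto simp: cylinder_def)
        show "emeasure code_measure (cylinder \<omega> B) \<le> ennreal (D powr s * diameter U powr s)"
          using cylinder_measure(2)[OF E[OF \<omega>(1)], of B] ennreal_leI[OF bound]
          unfolding P_def by (rule order_trans)
      qed
    qed
    then show "\<exists>V\<in>sets code_measure. {\<omega> \<in> space code_measure. cf_lim (digits \<omega>) \<in> U} \<subseteq> V \<and>
        emeasure code_measure V \<le> ennreal (D powr s * diameter U powr s)"
      unfolding E_def .
  qed
qed

end

section \<open>Membership in the limit set and growth of the normalising sequence\<close>

lemma (in block_code) quotient_sum_digits: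
  assumes "\<omega> \<in> seqs"
  shows "quotient_sum n (cf_lim (digits \<omega>)) = (\<Sum>j<n. digits \<omega> j)"
  by (rule quotient_sum_cf_lim) (rule digits_pos[OF assms])

text \<open>The two digit sums differ by at most \<open>S\<close>, whereas the reference sum is at
  least \<open>n\<close>, so their ratio tends to 1.\<close>

lemma (in block_code) code_in_limit_set:
  assumes "\<alpha> > 0" "\<omega>\<^sub>0 \<in> seqs" "\<omega> \<in> seqs"
  shows "cf_lim (digits \<omega>) \<in> quotient_sum_limit_set (\<lambda>n. real (\<Sum>j<n. digits \<omega>\<^sub>0 j) / \<alpha>) \<alpha>"
proof -
  define \<sigma> \<sigma>\<^sub>0 where "\<sigma> n = real (\<Sum>j<n. digits \<omega> j)" and "\<sigma>\<^sub>0 n = real (\<Sum>j<n. digits \<omega>\<^sub>0 j)" for n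
  have ge: "\<sigma>\<^sub>0 n \<ge> real n" for n
  proof -
    have "(\<Sum>j<n. 1) \<le> (\<Sum>j<n. digits \<omega>\<^sub>0 j)"
      using digits_pos[OF assms(2)] by (intro sum_mono) (simp add: Suc_leI)
    then have "n \<le> (\<Sum>j<n. digits \<omega>\<^sub>0 j)" by simp
    then show ?thesis by (simp only: \<sigma>\<^sub>0_def of_nat_le_iff)
  qed
  have diff: "\<bar>\<sigma> n - \<sigma>\<^sub>0 n\<bar> \<le> real S" for n
    using digit_sum_diff_le[OF assms(2,3), of n] digit_sum_diff_le[OF assms(3,2), of n]
    unfolding \<sigma>_def \<sigma>\<^sub>0_def by linarith
  have "(\<lambda>n. \<sigma> n / (\<sigma>\<^sub>0 n / \<alpha>) - \<alpha>) \<longlonglongrightarrow> 0"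
  proof (rule Lim_null_comparison)
    show "(\<lambda>n. \<alpha> * real S / real n) \<longlonglongrightarrow> 0" by real_asymp
    show "\<forall>\<^sub>F n in sequentially. norm (\<sigma> n / (\<sigma>\<^sub>0 n / \<alpha>) - \<alpha>) \<le> \<alpha> * real S / real n"
      using eventually_gt_at_top[of 0]
    proof eventually_elim
      case (elim n)
      then have pos: "\<sigma>\<^sub>0 n > 0" using ge[of n] by simp
      then have "\<sigma> n / (\<sigma>\<^sub>0 n / \<alpha>) - \<alpha> = \<alpha> * (\<sigma> n - \<sigma>\<^sub>0 n) / \<sigma>\<^sub>0 n"
        using assms(1) by (simp add: field_simps)
      then have "norm (\<sigma> n / (\<sigma>\<^sub>0 n / \<alpha>) - \<alpha>) = \<alpha> * \<bar>\<sigma> n - \<sigma>\<^sub>0 n\<bar> / \<sigma>\<^sub>0 n"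
        using pos assms(1) by (simp add: abs_mult)
      also have "\<dots> \<le> \<alpha> * real S / real n"
        using assms(1) diff[of n] ge[of n] elim by (intro frac_le mult_left_mono) auto
      finally show ?case .
    qed
  qed
  then have "(\<lambda>n. \<sigma> n / (\<sigma>\<^sub>0 n / \<alpha>)) \<longlonglongrightarrow> \<alpha>" by (rule LIM_zero_cancel)
  then show ?thesis
    using cf_lim_bounds[of "digits \<omega>"] cf_lim_irrational[of "digits \<omega>"] digits_pos[OF assms(3)]
    by (simp add: quotient_sum_limit_set_def quotient_sum_digits[OF assms(3)] \<sigma>_def \<sigma>\<^sub>0_def)
qed

context block_code
begin

context
  fixes \<omega> and \<alpha> :: real and \<phi>
  assumes \<omega>: "\<omega> \<in> seqs" and \<alpha>: "\<alpha> > 0"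
    and often: "\<And>N. \<exists>i\<ge>N. b i = i\<^sup>2 \<and> (\<Sum>j<i. b j) \<le> 2 * i"
  defines "\<phi> \<equiv> \<lambda>n. real (\<Sum>j<n. digits \<omega> j) / \<alpha>"
begin

text \<open>Sampled at block boundaries just before a large digit \<open>b i\<close>: there the
  prescribed digits sum to at most 2 i and the free ones to i S.\<close>

lemma liminf_average_finite: "liminf (\<lambda>n. ereal (\<phi> n / real n)) < \<infinity>"
proof -
  define c where "c = (2 + real S) / \<alpha>"
  have "\<not> ereal c < liminf (\<lambda>n. ereal (\<phi> n / real n))"
  proof
    assume "ereal c < liminf (\<lambda>n. ereal (\<phi> n / real n))"
    then have "\<forall>\<^sub>F n in sequentially. ereal c < ereal (\<phi> n / real n)" by (rule less_LiminfD)
    then obtain N where N: "\<And>n. n \<ge> N \<Longrightarrow> c < \<phi> n / real n"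
      by (auto simp: eventually_sequentially)
    obtain i where i: "i \<ge> Suc N" "(\<Sum>j<i. b j) \<le> 2 * i" using often by blast
    have n: "i * Suc L \<ge> i" "i * Suc L > 0" using i by auto
    have "(\<Sum>j<i * Suc L. digits \<omega> j) \<le> 2 * i + i * S"
      unfolding digit_sum_blocks[OF \<omega>] using i by simp
    also have "\<dots> = (2 + S) * i" by (simp add: algebra_simps)
    also have "\<dots> \<le> (2 + S) * (i * Suc L)" by (intro mult_left_mono) auto
    finally have "real (\<Sum>j<i * Suc L. digits \<omega> j) \<le> real ((2 + S) * (i * Suc L))"
      by (simp only: of_nat_le_iff)
    also have "\<dots> = (2 + real S) * real (i * Suc L)"
      by (simp only: of_nat_mult of_nat_add of_nat_numeral)
    finally have "real (\<Sum>j<i * Suc L. digits \<omega> j) \<le> (2 + real S) * real (i * Suc L)" .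
    then have "\<phi> (i * Suc L) / real (i * Suc L) \<le> c"
      using \<alpha> n(2) unfolding \<phi>_def c_def by (simp add: divide_simps mult_ac del: mult_Suc_right)
    moreover have "c < \<phi> (i * Suc L) / real (i * Suc L)" by (rule N) (use i(1) n(1) in linarith)
    ultimately show False by simp
  qed
  then have "liminf (\<lambda>n. ereal (\<phi> n / real n)) \<le> ereal c" by simp
  also have "ereal c < \<infinity>" by simp
  finally show ?thesis .
qed

text \<open>Sampled one position later, when the digit \<open>i\<^sup>2\<close> has just been added
  although the index is still linear in \<open>i\<close>.\<close>

lemma limsup_average_infinite: "limsup (\<lambda>n. ereal (\<phi> n / real n)) = \<infinity>"
proof (rule ccontr)
  assume "limsup (\<lambda>n. ereal (\<phi> n / real n)) \<noteq> \<infinity>"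
  then obtain K :: nat where "limsup (\<lambda>n. ereal (\<phi> n / real n)) < ereal (real K)"
    using less_PInf_Ex_of_nat by (metis ereal_infty_less(1))
  then have "\<forall>\<^sub>F n in sequentially. ereal (\<phi> n / real n) < ereal (real K)" by (rule Limsup_lessD)
  then obtain N where N: "\<And>n. n \<ge> N \<Longrightarrow> \<phi> n / real n < real K"
    by (auto simp: eventually_sequentially)
  \<comment> \<open>For i > T the digit \<open>i\<^sup>2\<close> outweighs \<alpha> K n, because n =
    i (L + 1) + 1 is at most i (L + 2).\<close>
  obtain T :: nat where T: "real T \<ge> \<alpha> * real K * real (Suc (Suc L))" using real_arch_simple by blast
  obtain i where i: "i \<ge> Suc (max N T)" "b i = i\<^sup>2" using often by blast
  define n where "n = Suc (i * Suc L)"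
  have "\<phi> n / real n < real K" by (rule N) (use i(1) in \<open>simp add: n_def\<close>)
  moreover have "x < \<alpha> * real K * r" if "x / \<alpha> / r < real K" "r > 0" for x r
    using that \<alpha> by (simp add: pos_divide_less_eq mult_ac)
  moreover have "real n > 0" by (simp add: n_def del: of_nat_Suc)
  ultimately have "real (\<Sum>j<n. digits \<omega> j) < \<alpha> * real K * real n"
    unfolding \<phi>_def by blast
  moreover have "real i ^ 2 \<le> real (\<Sum>j<n. digits \<omega> j)"
  proof -
    have "i\<^sup>2 \<le> (\<Sum>j<n. digits \<omega> j)"
      unfolding n_def sum.lessThan_Suc digits_block_start i(2) by simp
    then show ?thesis by (metis of_nat_le_iff of_nat_power)
  qed
  moreover have "\<alpha> * real K * real n \<le> \<alpha> * real K * real (i * Suc (Suc L))"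
    using \<alpha> i(1) by (intro mult_left_mono of_nat_mono) (auto simp: n_def)
  moreover have "\<alpha> * real K * real (i * Suc (Suc L)) \<le> real i * real i"
  proof -
    have "\<alpha> * real K * real (Suc (Suc L)) * real i \<le> real i * real i"
      using T i(1) by (intro mult_right_mono) auto
    then show ?thesis by (simp only: of_nat_mult mult_ac)
  qed
  ultimately show False by (simp add: power2_eq_square)
qed

end

end

section \<open>Choice of the exponent and assembly\<close>

theorem theorem3:
  fixes \<alpha> :: real
  assumes "\<alpha> > 0"
  shows "\<forall>\<epsilon>::real. \<epsilon> > 0 \<longrightarrow>
    (\<exists>\<phi> :: nat \<Rightarrow> real.
       (\<forall>n\<ge>1. \<phi> n > 0) \<and>
       mono_on {1..} \<phi> \<and>
       liminf (\<lambda>n. ereal (\<phi> n / real n)) < \<infinity> \<and>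
       limsup (\<lambda>n. ereal (\<phi> n / real n)) = \<infinity> \<and>
       1 - hausdorff_dim (quotient_sum_limit_set \<phi> \<alpha>) < ereal \<epsilon>)"
proof (intro allI impI)
  fix \<epsilon> :: real assume "\<epsilon> > 0"
  \<comment> \<open>Halving \<epsilon> gives the strict inequality at the end; the cap 1/2 keeps
    \<open>s\<close> positive for large \<epsilon>.\<close>
  define s where "s = 1 - min (\<epsilon> / 2) (1 / 2)"
  have s_bounds: "0 < s" "s < 1" "1 - s < \<epsilon>" using \<open>\<epsilon> > 0\<close> by (auto simp: s_def min_def)
  obtain M L S W where word_set: "W \<subseteq> words M L" "L \<ge> 1" "\<forall>w\<in>W. sum_list w = S"
    "(\<Sum>w\<in>W. cf_size w powr (- s)) \<ge> 16"
    by (rule words_constant_sum[OF s_bounds(2), of 16]) (rule that; assumption)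
  obtain b :: "nat \<Rightarrow> nat" where b: "\<And>i. b i > 0" "\<And>n. (\<Prod>i<n. b i * (b i + 1)) \<le> 4 ^ n"
    "\<And>N. \<exists>i\<ge>N. b i = i\<^sup>2 \<and> (\<Sum>j<i. b j) \<le> 2 * i"
    by (rule sparse_large_digits) (rule that; assumption)
  interpret growing_block_code M L S W b s
    by unfold_locales (rule word_set bspec[OF word_set(3)] b s_bounds less_imp_le[OF s_bounds(2)] | assumption)+
  have "W \<noteq> {}" using word_set(4) by auto
  then obtain w where "w \<in> W" by blast
  \<comment> \<open>Any coding may serve as the reference for \<phi>; repeating one word is the
    simplest.\<close>
  define \<omega> where "\<omega> = (\<lambda>i::nat. w)"
  have \<omega>: "\<omega> \<in> seqs" using \<open>w \<in> W\<close> by (simp add: \<omega>_def)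
  define \<phi> where "\<phi> = (\<lambda>n. real (\<Sum>j<n. digits \<omega> j) / \<alpha>)"
  have "\<forall>n\<ge>1. \<phi> n > 0"
  proof (intro allI impI)
    fix n :: nat assume "n \<ge> 1"
    then have "(\<Sum>j<n. digits \<omega> j) > 0"
      using digits_pos[OF \<omega>] by (intro sum_pos) (auto simp: lessThan_empty_iff)
    then show "\<phi> n > 0"
      using assms unfolding \<phi>_def by (intro divide_pos_pos) (simp_all only: of_nat_0_less_iff)
  qed
  moreover have "mono_on {1..} \<phi>"
  proof (rule mono_onI)
    fix m n :: nat assume "m \<le> n"
    then have "(\<Sum>j<m. digits \<omega> j) \<le> (\<Sum>j<n. digits \<omega> j)" by (intro sum_mono2) auto
    then show "\<phi> m \<le> \<phi> n" using assms unfolding \<phi>_def by (intro divide_right_mono of_nat_mono) auto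
  qed
  moreover have "liminf (\<lambda>n. ereal (\<phi> n / real n)) < \<infinity>" "limsup (\<lambda>n. ereal (\<phi> n / real n)) = \<infinity>"
    unfolding \<phi>_def using liminf_average_finite[OF \<omega> assms b(3)] limsup_average_infinite[OF \<omega> assms b(3)]
    by blast+
  moreover have "1 - hausdorff_dim (quotient_sum_limit_set \<phi> \<alpha>) < ereal \<epsilon>"
  proof -
    have "ereal s \<le> hausdorff_dim (quotient_sum_limit_set \<phi> \<alpha>)"
      unfolding \<phi>_def by (intro hausdorff_dim_code code_in_limit_set assms \<omega>)
    then have "1 - hausdorff_dim (quotient_sum_limit_set \<phi> \<alpha>) \<le> 1 - ereal s"
      by (intro ereal_minus_mono) auto
    also have "\<dots> = ereal (1 - s)" by (simp add: one_ereal_def)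
    also have "\<dots> < ereal \<epsilon>" using s_bounds(3) by simp
    finally show ?thesis .
  qed
  ultimately show "\<exists>\<phi> :: nat \<Rightarrow> real.
       (\<forall>n\<ge>1. \<phi> n > 0) \<and>
       mono_on {1..} \<phi> \<and>
       liminf (\<lambda>n. ereal (\<phi> n / real n)) < \<infinity> \<and>
       limsup (\<lambda>n. ereal (\<phi> n / real n)) = \<infinity> \<and>
       1 - hausdorff_dim (quotient_sum_limit_set \<phi> \<alpha>) < ereal \<epsilon>" by blast
qed

end
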